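(* Let $S\subset\mathbb{R}^n$ be a closed set containing the origin, let $(\Xi,\mathcal{A},\mathbb{P})$ be a complete probability space, let $F\subset\mathrm{usc\text{-}fcns}(S)$ be closed and bounded with respect to $d$, and let $F^0\subset F$ and $F^\nu\subset F$, $\nu\in\mathbb{N}$, be closed (and bounded). Suppose that $\psi:\Xi\times F\to(-\infty,\infty]$ is a random lsc function for which there exist $p\in(0,\infty)$ and an integrable random variable $\kappa:\Xi\to[0,\infty)$ such that $$|\psi(\xi,f)-\psi(\xi,g)|\le\kappa(\xi)\,[d(f,g)]^p\quad\text{for all } f,g\in F\text{ and }\xi\in\Xi.$$ Suppose also that $\boldsymbol{\xi}^1,\boldsymbol{\xi}^2,\dots$ are independent random elements, each with values in $\Xi$ and distributed according to $\mathbb{P}$, and that $\psi(\boldsymbol{\xi}^1,f)$ is sub-exponential for all $f\in F$. Let $$r^\nu=\nu^{\frac{-1}{2+n/p}}(\log\nu)^{\frac{1+n}{2+n/p}}.$$ If $\mathbb{H}(F^\nu,F^0)=o\big(\min\{r^\nu,(r^\nu)^{1/p}\}\big)$ and $\alpha\in(0,1)$, then there exist $c\in[0,\infty)$ and $\bar\nu\in\mathbb{N}$ such that for all $\nu\ge\bar\nu$ and $\varepsilon^\nu\ge0$, $$P^\nu\left[\mathrm{exs}\Big(\varepsilon^\nu\text{-}\mathop{\mathrm{argmin}}_{f\in F^\nu}\frac1\nu\sum_{j=1}^\nu\psi(\boldsymbol{\xi}^j,f),\ \ (\varepsilon^\nu+cr^\nu)\text{-}\mathop{\mathrm{argmin}}_{f\in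 F^0}\mathbb{E}[\psi(\boldsymbol{\xi}^1,f)]\Big)\le\mathbb{H}(F^\nu,F^0)\right]\ge1-\alpha.$$
   Context: For $f:S\to[-\infty,\infty]$, $\mathrm{hypo} f=\{(x,\alpha)\in S\times\mathbb{R}: f(x)\ge\alpha\}$, and $\mathrm{usc\text{-}fcns}(S)=\{f:S\to[-\infty,\infty]:\mathrm{hypo} f\text{ is nonempty and closed}\}$. The Attouch–Wets distance is $$d(f,g)=\int_0^\infty d_\rho(f,g)\,e^{-\rho}\,d\rho,\qquad d_\rho(f,g)=\max_{z\in S\times\mathbb{R},\ \|z\|_\infty\le\rho}\big|\mathrm{dist}_\infty(z,\mathrm{hypo} f)-\mathrm{dist}_\infty(z,\mathrm{hypo} g)\big|,$$ with $\mathrm{dist}_\infty(z,A)=\inf_{a\in A}\|z-a\|_\infty$. It makes $\mathrm{usc\text{-}fcns}(S)$ a complete separable metric space in which closed bounded sets are compact. $\psi:\Xi\times F\to[-\infty,\infty]$ is a random lsc function if $\psi(\xi,\cdot)$ is lower semicontinuous on $(F,d)$ for every $\xi\in\Xi$ and $\psi$ is measurable with respect to the product sigma-algebra on $\Xi\times F$ (Borel sigma-algebra on $(F,d)$). $\mathbb{E}$ denotes expectation under $\mathbb{P}$ (with the convention $\infty-\infty=\infty$). A random variable $Y$ is sub-exponential if for some $\lambda\ge0$, $\mathbb{E}[\exp(\tau(Y-\mathbb{E}Y))]\le\exp(\tau^2\lambda^2/2)$ for all $|\tau|\le1/\lambda$ (in particular $\mathbb{E}Y$ is finite). $P^\nu$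 is the measure of the $\nu$-fold product of $(\Xi,\mathcal{A},\mathbb{P})$. For $G\subset F$, $\phi:G\to[-\infty,\infty]$ and $\varepsilon\ge0$, $\varepsilon\text{-}\mathop{\mathrm{argmin}}_{f\in G}\phi(f)=\{f\in G:\phi(f)\le\inf_{g\in G}\phi(g)+\varepsilon\}$ (which equals $G$ if $\phi\equiv\infty$ on $G$). For $F_1,F_2\subset F$, the excess is $\mathrm{exs}(F_1,F_2)=\sup_{f\in F_1}\inf_{g\in F_2}d(f,g)$ if both are nonempty, $\mathrm{exs}(F_1,F_2)=\infty$ if $F_1$ is nonempty and $F_2$ is empty, and $\mathrm{exs}(F_1,F_2)=0$ otherwise. The Pompeiu–Hausdorff distance is $\mathbb{H}(F_1,F_2)=\max\{\mathrm{exs}(F_1,F_2),\mathrm{exs}(F_2,F_1)\}$. The notation $\alpha^\nu=o(s^\nu)$ means that for every $\eta>0$ there is $\bar\nu$ such that $\alpha^\nu\le\eta s^\nu$ for all $\nu\ge\bar\nu$.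
   Formalization: The hypothesis that ψ(ξ^1,f) is sub-exponential for all f in F is taken with one common parameter λ for all f in F; with λ allowed to depend on f the claim is false (κ heavy-tailed, bounded truncations on a sequence of constant functions). *)

theory Defs
  imports "HOL-Probability.Probability"
begin

section \<open>Upper semicontinuous functions and the Attouch-Wets distance\<close>

definition hypo :: "'v set \<Rightarrow> ('v \<Rightarrow> ereal) \<Rightarrow> ('v \<times> real) set" where
  "hypo S f = {(x, a). x \<in> S \<and> ereal a \<le> f x}"

text \<open>Functions on \<open>S\<close> are extensional, so that \<open>aw_dist S f g = 0\<close> implies \<open>f = g\<close>.\<close>

definition usc_fcns :: "(real ^ 'n) set \<Rightarrow> (real ^ 'n \<Rightarrow> ereal) set" where
  "usc_fcns S = {f \<in> S \<rightarrow>\<^sub>E UNIV. hypo S f \<noteq> {} \<and> closed (hypo S f)}"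

text \<open>On \<^typ>\<open>(real ^ 'n) \<times> real\<close>, \<^const>\<open>infnorm\<close> is the maximum of the absolute values of
  all \<open>n + 1\<close> coordinates.\<close>

definition dist_inf :: "'v::euclidean_space \<Rightarrow> 'v set \<Rightarrow> real" where
  "dist_inf z A = (INF a\<in>A. infnorm (z - a))"

text \<open>For closed \<open>S\<close> containing \<open>0\<close> and \<open>\<rho> \<ge> 0\<close> the supremum is over a nonempty compact set
  and of a continuous function, hence a maximum.\<close>

definition aw_dist_rho ::
    "(real ^ 'n) set \<Rightarrow> real \<Rightarrow> (real ^ 'n \<Rightarrow> ereal) \<Rightarrow> (real ^ 'n \<Rightarrow> ereal) \<Rightarrow> real" where
  "aw_dist_rho S \<rho> f g =
     (SUP z \<in> {z \<in> S \<times> UNIV. infnorm z \<le> \<rho>}. \<bar>dist_inf z (hypo S f) - dist_inf z (hypo S g)\<bar>)"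

definition aw_dist ::
    "(real ^ 'n) set \<Rightarrow> (real ^ 'n \<Rightarrow> ereal) \<Rightarrow> (real ^ 'n \<Rightarrow> ereal) \<Rightarrow> real" where
  "aw_dist S f g = (LINT \<rho>:{0..}|lborel. aw_dist_rho S \<rho> f g * exp (- \<rho>))"

section \<open>Near-minimizers, excess and Pompeiu-Hausdorff distance\<close>

definition eps_argmin :: "real \<Rightarrow> 'f set \<Rightarrow> ('f \<Rightarrow> ereal) \<Rightarrow> 'f set" where
  "eps_argmin \<epsilon> G \<phi> = {f \<in> G. \<phi> f \<le> (INF g\<in>G. \<phi> g) + ereal \<epsilon>}"

definition exs :: "('f \<Rightarrow> 'f \<Rightarrow> real) \<Rightarrow> 'f set \<Rightarrow> 'f set \<Rightarrow> ereal" where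
  "exs d F1 F2 =
     (if F1 \<noteq> {} \<and> F2 \<noteq> {} then (SUP f\<in>F1. INF g\<in>F2. ereal (d f g))
      else if F1 \<noteq> {} then \<infinity> else 0)"

definition ph_dist :: "('f \<Rightarrow> 'f \<Rightarrow> real) \<Rightarrow> 'f set \<Rightarrow> 'f set \<Rightarrow> ereal" where
  "ph_dist d F1 F2 = max (exs d F1 F2) (exs d F2 F1)"

definition little_o_seq :: "(nat \<Rightarrow> ereal) \<Rightarrow> (nat \<Rightarrow> real) \<Rightarrow> bool" where
  "little_o_seq a s \<longleftrightarrow> (\<forall>\<eta>>0. \<exists>N. \<forall>\<nu>\<ge>N. a \<nu> \<le> ereal (\<eta> * s \<nu>))"

section \<open>Random lsc functions and sub-exponential random variables\<close>

definition lsc_map :: "'f topology \<Rightarrow> ('f \<Rightarrow> ereal) \<Rightarrow> bool" where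
  "lsc_map X \<phi> \<longleftrightarrow>
     (\<forall>f \<in> topspace X. \<forall>a < \<phi> f. \<exists>U. openin X U \<and> f \<in> U \<and> (\<forall>g\<in>U. a < \<phi> g))"

definition borel_metric :: "'f set \<Rightarrow> ('f \<Rightarrow> 'f \<Rightarrow> real) \<Rightarrow> 'f measure" where
  "borel_metric F d = sigma F {U. openin (Metric_space.mtopology F d) U}"

definition random_lsc ::
    "'x measure \<Rightarrow> 'f set \<Rightarrow> ('f \<Rightarrow> 'f \<Rightarrow> real) \<Rightarrow> ('x \<Rightarrow> 'f \<Rightarrow> ereal) \<Rightarrow> bool" where
  "random_lsc P F d \<psi> \<longleftrightarrow>
     (\<forall>\<xi> \<in> space P. lsc_map (Metric_space.mtopology F d) (\<psi> \<xi>)) \<and>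
     (\<lambda>(\<xi>, f). \<psi> \<xi> f) \<in> borel_measurable (P \<Otimes>\<^sub>M borel_metric F d)"

text \<open>Positive part minus negative part; subtraction on \<^typ>\<open>ereal\<close> satisfies
  \<open>\<infinity> - \<infinity> = \<infinity>\<close>, and \<^const>\<open>e2ennreal\<close> sends negative values to \<open>0\<close>.\<close>

definition expect :: "'x measure \<Rightarrow> ('x \<Rightarrow> ereal) \<Rightarrow> ereal" where
  "expect P Y = enn2ereal (\<integral>\<^sup>+\<xi>. e2ennreal (Y \<xi>) \<partial>P) - enn2ereal (\<integral>\<^sup>+\<xi>. e2ennreal (- Y \<xi>) \<partial>P)"

text \<open>The range of \<open>\<tau>\<close> is \<open>\<bar>\<tau>\<bar> \<le> 1 / lam\<close> with \<open>1 / 0 = \<infinity>\<close>: for \<open>lam = 0\<close> the inequality is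
  required for every \<open>\<tau>\<close>. Finiteness of the expectation makes \<open>Y\<close> finite almost surely, so
  \<^const>\<open>real_of_ereal\<close> alters it on a null set only. A random variable is sub-exponential if
  this holds for some \<open>lam \<ge> 0\<close>. The parameter is kept explicit because the theorem needs one
  \<open>lam\<close> that serves all \<open>f \<in> F\<close>; with \<open>lam\<close> depending on \<open>f\<close> it fails.\<close>

definition sub_exponential_with :: "'x measure \<Rightarrow> real \<Rightarrow> ('x \<Rightarrow> ereal) \<Rightarrow> bool" where
  "sub_exponential_with P lam Y \<longleftrightarrow>
     Y \<in> borel_measurable P \<and> \<bar>expect P Y\<bar> \<noteq> \<infinity> \<and>
     (\<forall>\<tau>. \<bar>\<tau>\<bar> * lam \<le> 1 \<longrightarrow>
        (\<integral>\<^sup>+\<xi>. ennreal (exp (\<tau> * (real_of_ereal (Y \<xi>) - real_of_ereal (expect P Y)))) \<partial>P)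
          \<le> ennreal (exp (\<tau>\<^sup>2 * lam\<^sup>2 / 2)))"

section \<open>The rate\<close>

definition rate :: "nat \<Rightarrow> real \<Rightarrow> nat \<Rightarrow> real" where
  "rate n p \<nu> = real \<nu> powr (- 1 / (2 + real n / p))
                 * ln (real \<nu>) powr ((1 + real n) / (2 + real n / p))"

end

theory Submission
  imports Defs "HOL-Real_Asymp.Real_Asymp"
begin

text \<open>The Hoelder condition with \<open>f = g\<close> forces \<open>\<psi>\<close> to be finite on \<open>F\<close>. A bounded set of
  usc functions has an \<open>O(\<delta>)\<close>-net of cardinality at most \<open>exp (C * ln (1 / \<delta>) ^ (n + 1) / \<delta> ^ n)\<close>:
  because of the weight \<open>exp (- \<rho>)\<close> only the part of a hypograph in a box of radius
  \<open>O(ln (1 / \<delta>))\<close> matters, and on a grid of mesh \<open>\<delta>\<close> it is described by the height over each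
  of the \<open>O(ln (1 / \<delta>) / \<delta>) ^ n\<close> columns. Chernoff's bound on the net, and Markov's inequality for the
  sample mean of \<open>\<kappa>\<close> off the net, show that with probability \<open>1 - \<alpha>\<close> the sample means differ from the
  expectations by \<open>O(rate)\<close> uniformly on \<open>F\<close>. On that event a near-minimizer over \<open>Fn \<nu>\<close> is close
  to a point of \<open>F0\<close>, and every such point is a near-minimizer over \<open>F0\<close>. The event in the theorem
  itself must be shown to be measurable, for which compactness of \<open>Fn \<nu>\<close> is used.\<close>

section \<open>Distance to a set in the maximum norm\<close>

text \<open>The Attouch-Wets distance is used through two inequalities: the gap between two distance
  functions at \<open>z\<close> is at most \<open>exp (infnorm z)\<close> times
  \<open>aw_dist\<close>, and gaps of at most \<delta> on the box of radius \<open>r\<close> bound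
  \<open>aw_dist\<close> by \<delta> plus a multiple of \<open>exp (- r / 2)\<close>. Completeness,
  the bound on distances at the origin and the nets rest on them; boundedness of \<open>F\<close>
  makes the multiple uniform. The event asks for an excess of at most the Hausdorff distance
  \<open>h\<close> itself, with no slack, while an infimum of distances is only approached. So every
  point of \<open>F0\<close> at distance less than \<open>h + e\<close> from a near-minimizer is
  shown to be a near-minimizer, for all \<open>e\<close> up to \<open>rate powr (1 / p)\<close>;
  every loss goes into \<open>c\<close>. Since \<open>measure\<close> is 0 outside the
  sigma-algebra, the lower bound needs measurability of the event and not only a large subset of
  it.\<close>

lemma infnorm_le_iff: "infnorm z \<le> c \<longleftrightarrow> (\<forall>b\<in>Basis. \<bar>z \<bullet> b\<bar> \<le> c)"
  by (simp add: infnorm_Max)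

lemma infnorm_Pair_le_iff:
  fixes x :: "real ^ 'n" and a :: real
  shows "infnorm (x, a) \<le> c \<longleftrightarrow> (\<forall>i. \<bar>x $ i\<bar> \<le> c) \<and> \<bar>a\<bar> \<le> c"
  by (auto simp: infnorm_le_iff Basis_prod_def Basis_vec_def inner_axis)

lemma infnorm_triangle_diff:
  fixes x y z :: "'v::euclidean_space"
  shows "infnorm (x - z) \<le> infnorm (x - y) + infnorm (y - z)"
  using infnorm_triangle[of "x - y" "y - z"] by simp

lemma dist_inf_le: "a \<in> A \<Longrightarrow> dist_inf z A \<le> infnorm (z - a)"
  unfolding dist_inf_def by (rule cINF_lower) (auto intro!: bdd_belowI[of _ 0] infnorm_pos_le)

lemma dist_inf_greatest: "A \<noteq> {} \<Longrightarrow> (\<And>a. a \<in> A \<Longrightarrow> c \<le> infnorm (z - a)) \<Longrightarrow> c \<le> dist_inf z A"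
  unfolding dist_inf_def by (rule cINF_greatest)

lemma dist_inf_nonneg: "A \<noteq> {} \<Longrightarrow> 0 \<le> dist_inf z A"
  by (rule dist_inf_greatest) (auto intro: infnorm_pos_le)

lemma dist_inf_nearE:
  assumes "A \<noteq> {}" "0 < e"
  obtains a where "a \<in> A" "infnorm (z - a) < dist_inf z A + e"
proof -
  have "\<not> (\<forall>a\<in>A. dist_inf z A + e \<le> infnorm (z - a))"
    using dist_inf_greatest[of A "dist_inf z A + e" z] assms by auto
  then show ?thesis using that by force
qed

lemma dist_inf_triangle: "dist_inf z A \<le> infnorm (z - w) + dist_inf w A"
proof (cases "A = {}")
  case True
  then show ?thesis by (simp add: dist_inf_def infnorm_pos_le)
next
  case False
  have "dist_inf z A - infnorm (z - w) \<le> dist_inf w A"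
  proof (rule dist_inf_greatest[OF False])
    fix a assume "a \<in> A"
    then show "dist_inf z A - infnorm (z - w) \<le> infnorm (w - a)"
      using dist_inf_le[of a A z] infnorm_triangle_diff[of z a w] by linarith
  qed
  then show ?thesis by linarith
qed

lemma dist_inf_lipschitz: "\<bar>dist_inf z A - dist_inf w A\<bar> \<le> infnorm (z - w)"
  using dist_inf_triangle[of z A w] dist_inf_triangle[of w A z]
  by (simp add: infnorm_sub abs_le_iff)

lemma infnorm_tendsto_0_imp:
  fixes w :: "nat \<Rightarrow> 'v::euclidean_space"
  assumes "(\<lambda>n. infnorm (w n - z)) \<longlonglongrightarrow> 0"
  shows "w \<longlonglongrightarrow> z"
proof -
  have "(\<lambda>n. w n - z) \<longlonglongrightarrow> 0"
  proof (rule Lim_null_comparison)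
    show "\<forall>\<^sub>F n in sequentially. norm (w n - z) \<le> sqrt DIM('v) * infnorm (w n - z)"
      by (simp add: norm_le_infnorm)
    show "(\<lambda>n. sqrt DIM('v) * infnorm (w n - z)) \<longlonglongrightarrow> 0"
      using tendsto_mult_right_zero[OF assms] .
  qed
  then show ?thesis by (simp add: LIM_zero_iff)
qed

lemma dist_inf_eq_0_iff:
  fixes A :: "'v::euclidean_space set"
  assumes "A \<noteq> {}" "closed A"
  shows "dist_inf z A = 0 \<longleftrightarrow> z \<in> A"
proof
  assume 0: "dist_inf z A = 0"
  have "\<exists>a\<in>A. infnorm (z - a) < 1 / Suc n" for n
    using dist_inf_nearE[OF assms(1), of "1 / Suc n" z] 0 by (metis add_0 of_nat_0_less_iff zero_less_Suc zero_less_divide_1_iff)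
  then obtain w where w: "\<And>n. w n \<in> A" "\<And>n. infnorm (z - w n) < 1 / Suc n" by metis
  have "(\<lambda>n. infnorm (w n - z)) \<longlonglongrightarrow> 0"
  proof (rule tendsto_sandwich[OF _ _ tendsto_const LIMSEQ_inverse_real_of_nat])
    show "\<forall>\<^sub>F n in sequentially. infnorm (w n - z) \<le> inverse (real (Suc n))"
      using w(2) by (intro always_eventually) (auto simp: infnorm_sub[of _ z] inverse_eq_divide intro: less_imp_le)
  qed (simp add: infnorm_pos_le)
  then have "w \<longlonglongrightarrow> z" by (rule infnorm_tendsto_0_imp)
  then show "z \<in> A" using closed_sequentially[OF assms(2) w(1)] by simp
next
  assume "z \<in> A"
  then show "dist_inf z A = 0"
    using dist_inf_le[of z A z] dist_inf_nonneg[OF assms(1), of z] by (simp add: infnorm_0)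
qed

section \<open>The Attouch-Wets metric\<close>

lemma set_integral_exp_Ici:
  fixes a c :: real
  assumes "0 < a"
  shows "set_integrable lborel {c..} (\<lambda>x. exp (- a * x))"
    and "(LINT x:{c..}|lborel. exp (- a * x)) = exp (- a * c) / a"
proof -
  have abs: "(\<lambda>x. exp (- a * x)) absolutely_integrable_on {c..}"
    by (rule nonnegative_absolutely_integrable_1[OF integrable_on_exp_minus_to_infinity[OF assms]]) auto
  \<comment> \<open>\<open>absolutely_integrable_on\<close> refers to \<open>lebesgue\<close>, the
    completion of \<open>lborel\<close>; for a Borel measurable integrand the two kinds of
    integrability agree.\<close>
  then show int: "set_integrable lborel {c..} (\<lambda>x. exp (- a * x))"
    unfolding set_integrable_def by (subst integrable_completion[symmetric]) auto
  show "(LINT x:{c..}|lborel. exp (- a * x)) = exp (- a * c) / a"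
    using set_borel_integral_eq_integral(2)[OF int] has_integral_exp_minus_to_infinity[OF assms, of c]
    by (simp add: integral_unique)
qed

abbreviation hdist :: "(real ^ 'n) set \<Rightarrow> (real ^ 'n) \<times> real \<Rightarrow> (real ^ 'n \<Rightarrow> ereal) \<Rightarrow> real" where
  "hdist S z f \<equiv> dist_inf z (hypo S f)"

lemma usc_fcnsD:
  assumes "f \<in> usc_fcns S"
  shows "hypo S f \<noteq> {}" "closed (hypo S f)"
  using assms by (auto simp: usc_fcns_def)

lemma hdist_le: "hdist S z f \<le> infnorm z + hdist S 0 f"
  using dist_inf_triangle[of z "hypo S f" 0] by simp

lemma hdist_nonneg: "f \<in> usc_fcns S \<Longrightarrow> 0 \<le> hdist S z f"
  by (simp add: dist_inf_nonneg usc_fcnsD)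

text \<open>Two nonnegative numbers differ by at most the larger one. This gives growth with slope 1
  in \<open>infnorm z\<close>, where the Lipschitz property of both distances would give slope
  2.\<close>

lemma hdist_gap_le:
  assumes "f \<in> usc_fcns S" "g \<in> usc_fcns S"
  shows "\<bar>hdist S z f - hdist S z g\<bar> \<le> infnorm z + (hdist S 0 f + hdist S 0 g)"
  using hdist_le[of z S f] hdist_le[of z S g] hdist_nonneg[of f S] hdist_nonneg[of g S] assms
  by (smt (verit))

text \<open>An extended real is determined by the reals below it, and outside \<open>S\<close> both
  functions are \<open>undefined\<close>.\<close>

lemma hypo_eq_imp_eq:
  assumes "f \<in> usc_fcns S" "g \<in> usc_fcns S" "hypo S f = hypo S g"
  shows "f = g"
proof
  fix x
  show "f x = g x"
  proof (cases "x \<in> S")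
    case True
    then have *: "ereal a \<le> f x \<longleftrightarrow> ereal a \<le> g x" for a
      using assms(3) by (auto simp: hypo_def set_eq_iff)
    have "\<not> u < v" if "\<And>a. ereal a \<le> u \<longleftrightarrow> ereal a \<le> v" for u v :: ereal
      using ereal_dense2[of u v] that by (metis less_imp_le not_less)
    then show ?thesis using * by (meson linorder_neqE)
  next
    case False
    then show ?thesis using assms(1,2) by (auto simp: usc_fcns_def PiE_def extensional_def)
  qed
qed

context
  fixes S :: "(real ^ 'n) set"
  assumes S: "0 \<in> S"
begin

text \<open>A supremum of reals is meaningful only for a bounded family, and the Lipschitz property
  of distances supplies the bound. Nothing is assumed of \<open>f\<close> and \<open>g\<close>,
  because \<open>Metric_space\<close> demands nonnegativity outside the carrier as well.\<close>

lemma aw_dist_rho_upper: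
  assumes "z \<in> S \<times> UNIV" "infnorm z \<le> \<rho>"
  shows "\<bar>hdist S z f - hdist S z g\<bar> \<le> aw_dist_rho S \<rho> f g"
  unfolding aw_dist_rho_def
proof (rule cSUP_upper)
  show "bdd_above ((\<lambda>z. \<bar>hdist S z f - hdist S z g\<bar>) ` {z \<in> S \<times> UNIV. infnorm z \<le> \<rho>})"
  proof (rule bdd_aboveI2)
    fix w :: "(real ^ 'n) \<times> real" assume "w \<in> {z \<in> S \<times> UNIV. infnorm z \<le> \<rho>}"
    then show "\<bar>hdist S w f - hdist S w g\<bar> \<le> 2 * \<rho> + \<bar>hdist S 0 f - hdist S 0 g\<bar>"
      using dist_inf_lipschitz[of w "hypo S f" 0] dist_inf_lipschitz[of w "hypo S g" 0] by auto
  qed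
qed (use assms in auto)

lemma aw_dist_rho_least:
  assumes "0 \<le> \<rho>" "\<And>z. z \<in> S \<times> UNIV \<Longrightarrow> infnorm z \<le> \<rho> \<Longrightarrow> \<bar>hdist S z f - hdist S z g\<bar> \<le> c"
  shows "aw_dist_rho S \<rho> f g \<le> c"
  unfolding aw_dist_rho_def
proof (rule cSUP_least)
  have "(0::(real ^ 'n) \<times> real) \<in> S \<times> UNIV" using S by (simp add: zero_prod_def)
  then have "0 \<in> {z \<in> S \<times> (UNIV::real set). infnorm z \<le> \<rho>}"
    unfolding mem_Collect_eq infnorm_0 using assms(1) by (rule conjI)
  then show "{z \<in> S \<times> (UNIV::real set). infnorm z \<le> \<rho>} \<noteq> {}"
    by (rule contrapos_pn) (rule equals0D)
qed (use assms in auto)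

lemma aw_dist_rho_nonneg:
  assumes "0 \<le> \<rho>"
  shows "0 \<le> aw_dist_rho S \<rho> f g"
proof -
  have "(0::(real ^ 'n) \<times> real) \<in> S \<times> UNIV" using S by (simp add: zero_prod_def)
  then show ?thesis using aw_dist_rho_upper[of 0 \<rho> f g] assms by (simp add: infnorm_0)
qed

lemma aw_dist_rho_le:
  assumes "f \<in> usc_fcns S" "g \<in> usc_fcns S" "0 \<le> \<rho>"
  shows "aw_dist_rho S \<rho> f g \<le> \<rho> + (hdist S 0 f + hdist S 0 g)"
proof (rule aw_dist_rho_least[OF assms(3)])
  fix z :: "(real ^ 'n) \<times> real" assume "infnorm z \<le> \<rho>"
  then show "\<bar>hdist S z f - hdist S z g\<bar> \<le> \<rho> + (hdist S 0 f + hdist S 0 g)"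
    using hdist_gap_le[OF assms(1,2), of z] by linarith
qed

lemma aw_dist_rho_mono:
  assumes "0 \<le> \<rho>" "\<rho> \<le> \<rho>'"
  shows "aw_dist_rho S \<rho> f g \<le> aw_dist_rho S \<rho>' f g"
  by (rule aw_dist_rho_least[OF assms(1)]) (use assms in \<open>auto intro!: aw_dist_rho_upper\<close>)

text \<open>The \<open>exp (- (3/4) * \<rho>)\<close> leaves room for the factor \<open>exp ((\<rho> - r) / 2)\<close> by which the
  tail \<open>\<rho> > r\<close> is estimated below.\<close>

lemma aw_dist_rho_integrand_le:
  assumes "f \<in> usc_fcns S" "g \<in> usc_fcns S" "hdist S 0 f + hdist S 0 g \<le> R" "0 \<le> \<rho>"
  shows "aw_dist_rho S \<rho> f g * exp (- \<rho>) \<le> (4 + R) * exp (- (3/4) * \<rho>)"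
proof -
  have R: "0 \<le> R" using assms hdist_nonneg[of f S 0] hdist_nonneg[of g S 0] by linarith
  have "1 + \<rho>/4 \<le> exp (\<rho>/4)" by (rule exp_ge_add_one_self)
  moreover have "R * 1 \<le> R * exp (\<rho>/4)" using R assms(4) by (intro mult_left_mono) auto
  ultimately have "\<rho> + R \<le> (4 + R) * exp (\<rho>/4)" unfolding distrib_right by linarith
  then have "aw_dist_rho S \<rho> f g \<le> (4 + R) * exp (\<rho>/4)"
    using aw_dist_rho_le[OF assms(1,2,4)] assms(3) by linarith
  then have "aw_dist_rho S \<rho> f g * exp (- \<rho>) \<le> (4 + R) * exp (\<rho>/4) * exp (- \<rho>)"
    by (rule mult_right_mono) auto
  also have "\<dots> = (4 + R) * exp (- (3/4) * \<rho>)"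
    by (simp add: mult.assoc exp_add[symmetric])
  finally show ?thesis .
qed

lemma aw_dist_rho_integrable:
  assumes "f \<in> usc_fcns S" "g \<in> usc_fcns S"
  shows "set_integrable lborel {0..} (\<lambda>\<rho>. aw_dist_rho S \<rho> f g * exp (- \<rho>))"
proof -
  define R where "R = hdist S 0 f + hdist S 0 g"
  \<comment> \<open>For negative \<rho> the supremum is over the empty set and has an unspecified
    value. Clipping at 0 restores monotonicity, and with it measurability.\<close>
  have "mono (\<lambda>\<rho>. aw_dist_rho S (max 0 \<rho>) f g)"
    by (auto intro!: monoI aw_dist_rho_mono)
  then have [measurable]: "(\<lambda>\<rho>. aw_dist_rho S (max 0 \<rho>) f g) \<in> borel_measurable borel"
    by (rule borel_measurable_mono)
  have "set_integrable lborel {0..} (\<lambda>\<rho>. aw_dist_rho S (max 0 \<rho>) f g * exp (- \<rho>))"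
  proof (rule set_integrable_bound)
    show "set_integrable lborel {0..} (\<lambda>\<rho>. (4 + R) * exp (- (3/4) * \<rho>))"
      using set_integral_exp_Ici(1)[of "3/4" 0] by (intro set_integrable_mult_right) simp
    show "set_borel_measurable lborel {0..} (\<lambda>\<rho>. aw_dist_rho S (max 0 \<rho>) f g * exp (- \<rho>))"
      unfolding set_borel_measurable_def by measurable
    show "AE \<rho> in lborel. \<rho> \<in> {0..} \<longrightarrow> norm (aw_dist_rho S (max 0 \<rho>) f g * exp (- \<rho>))
        \<le> norm ((4 + R) * exp (- (3/4) * \<rho>))"
    proof (intro AE_I2 impI)
      fix \<rho> :: real assume "\<rho> \<in> {0..}"
      then have "0 \<le> \<rho>" by simp
      then show "norm (aw_dist_rho S (max 0 \<rho>) f g * exp (- \<rho>)) \<le> norm ((4 + R) * exp (- (3/4) * \<rho>))"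
        using aw_dist_rho_integrand_le[OF assms, of R \<rho>] aw_dist_rho_nonneg[of \<rho> f g]
          hdist_nonneg[OF assms(1), of 0] hdist_nonneg[OF assms(2), of 0]
        by (auto simp: R_def abs_mult)
    qed
  qed
  then show ?thesis
    by (subst set_integrable_cong[OF refl refl, of _ _ "\<lambda>\<rho>. aw_dist_rho S (max 0 \<rho>) f g * exp (- \<rho>)"]) auto
qed

text \<open>The gap at \<open>z\<close> is counted in \<open>aw_dist_rho\<close> for every \<rho>
  from \<open>infnorm z\<close> on, and \<open>exp (- \<rho>)\<close> has integral
  \<open>exp (- infnorm z)\<close> there.\<close>

lemma aw_dist_lower:
  assumes "f \<in> usc_fcns S" "g \<in> usc_fcns S" "z \<in> S \<times> UNIV"
  shows "\<bar>hdist S z f - hdist S z g\<bar> \<le> exp (infnorm z) * aw_dist S f g"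
proof -
  define m and c where "m = infnorm z" and "c = \<bar>hdist S z f - hdist S z g\<bar>"
  have "(LINT \<rho>:{m..}|lborel. c * exp (- 1 * \<rho>)) \<le> (LINT \<rho>:{0..}|lborel. aw_dist_rho S \<rho> f g * exp (- \<rho>))"
    unfolding set_lebesgue_integral_def
  proof (rule integral_mono)
    show "integrable lborel (\<lambda>\<rho>. indicator {m..} \<rho> *\<^sub>R (c * exp (- 1 * \<rho>)))"
      using set_integrable_mult_right[of c lborel "{m..}" "\<lambda>\<rho>. exp (- 1 * \<rho>)"] set_integral_exp_Ici(1)[of 1 m]
      by (simp add: set_integrable_def)
    show "integrable lborel (\<lambda>\<rho>. indicator {0..} \<rho> *\<^sub>R (aw_dist_rho S \<rho> f g * exp (- \<rho>)))"
      using aw_dist_rho_integrable[OF assms(1,2)] by (simp add: set_integrable_def)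
    fix \<rho> :: real
    have "0 \<le> m" by (simp add: m_def infnorm_pos_le)
    then show "indicator {m..} \<rho> *\<^sub>R (c * exp (- 1 * \<rho>)) \<le> indicator {0..} \<rho> *\<^sub>R (aw_dist_rho S \<rho> f g * exp (- \<rho>))"
      using aw_dist_rho_upper[OF assms(3), of \<rho> f g] aw_dist_rho_nonneg[of \<rho> f g]
      by (auto simp: indicator_def c_def m_def)
  qed
  then have "c * exp (- m) \<le> aw_dist S f g"
    using set_integral_exp_Ici(2)[of 1 m] by (simp add: aw_dist_def)
  then have "c \<le> exp m * aw_dist S f g"
    by (simp add: exp_minus field_simps)
  then show ?thesis by (simp add: c_def m_def)
qed

text \<open>Radii up to \<open>r\<close> contribute at most \<delta>, as
  \<open>exp (- \<rho>)\<close> has integral 1. Beyond \<open>r\<close>,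
  \<open>exp (- (3/4) * \<rho>)\<close> is at most
  \<open>exp (- r / 2) * exp (- (1/4) * \<rho>)\<close>, and the factor 4 is the integral of the
  last exponential.\<close>

lemma aw_dist_upper:
  assumes fg: "f \<in> usc_fcns S" "g \<in> usc_fcns S" and R: "hdist S 0 f + hdist S 0 g \<le> R"
    and \<delta>: "0 \<le> \<delta>" and r: "0 \<le> r"
    and gap: "\<And>z. z \<in> S \<times> UNIV \<Longrightarrow> infnorm z \<le> r \<Longrightarrow> \<bar>hdist S z f - hdist S z g\<bar> \<le> \<delta>"
  shows "aw_dist S f g \<le> \<delta> + 4 * (4 + R) * exp (- r / 2)"
proof -
  have R0: "0 \<le> R" using R hdist_nonneg[OF fg(1), of 0] hdist_nonneg[OF fg(2), of 0] by linarith
  have i1: "set_integrable lborel {0..} (\<lambda>\<rho>. \<delta> * exp (- 1 * \<rho>))"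
    using set_integral_exp_Ici(1)[of 1 0] by (intro set_integrable_mult_right) simp
  have i2: "set_integrable lborel {0..} (\<lambda>\<rho>. ((4 + R) * exp (- r / 2)) * exp (- (1/4) * \<rho>))"
    using set_integral_exp_Ici(1)[of "1/4" 0] by (intro set_integrable_mult_right) simp
  have "aw_dist S f g \<le> (LINT \<rho>:{0..}|lborel. \<delta> * exp (- 1 * \<rho>) + ((4 + R) * exp (- r / 2)) * exp (- (1/4) * \<rho>))"
    unfolding aw_dist_def
  proof (rule set_integral_mono[OF aw_dist_rho_integrable[OF fg] set_integral_add(1)[OF i1 i2]])
    fix \<rho> :: real assume "\<rho> \<in> {0..}"
    then have \<rho>: "0 \<le> \<rho>" by simp
    show "aw_dist_rho S \<rho> f g * exp (- \<rho>)
        \<le> \<delta> * exp (- 1 * \<rho>) + ((4 + R) * exp (- r / 2)) * exp (- (1/4) * \<rho>)"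
    proof (cases "\<rho> \<le> r")
      case True
      then have "aw_dist_rho S \<rho> f g \<le> \<delta>" by (intro aw_dist_rho_least[OF \<rho>] gap) auto
      then have "aw_dist_rho S \<rho> f g * exp (- \<rho>) \<le> \<delta> * exp (- 1 * \<rho>)" by (simp add: mult_right_mono)
      then show ?thesis using R0 by (smt (verit) exp_gt_zero mult_nonneg_nonneg)
    next
      case False
      have "aw_dist_rho S \<rho> f g * exp (- \<rho>) \<le> (4 + R) * exp (- (3/4) * \<rho>)"
        by (rule aw_dist_rho_integrand_le[OF fg R \<rho>])
      also have "\<dots> \<le> (4 + R) * exp (- r / 2 + - (1/4) * \<rho>)"
        using False R0 by (intro mult_left_mono) auto
      also have "\<dots> = ((4 + R) * exp (- r / 2)) * exp (- (1/4) * \<rho>)" by (simp only: exp_add mult.assoc)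
      finally show ?thesis using \<delta> by (smt (verit) exp_gt_zero mult_nonneg_nonneg)
    qed
  qed
  also have "\<dots> = \<delta> + 4 * (4 + R) * exp (- r / 2)"
    unfolding set_integral_add(2)[OF i1 i2] set_integral_mult_right
    using set_integral_exp_Ici(2)[of 1 0] set_integral_exp_Ici(2)[of "1/4" 0] by simp
  finally show ?thesis .
qed

text \<open>A closed hypograph is the zero set of its distance function, and distance 0 makes the
  distance functions agree on \<open>S \<times> UNIV\<close>, where all hypographs lie.\<close>

lemma Metric_space_aw_dist: "Metric_space (usc_fcns S) (aw_dist S)"
proof
  fix f g :: "real ^ 'n \<Rightarrow> ereal"
  have "aw_dist_rho S \<rho> f g = aw_dist_rho S \<rho> g f" for \<rho>
    by (simp add: aw_dist_rho_def abs_minus_commute)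
  then show "aw_dist S f g = aw_dist S g f" by (simp add: aw_dist_def)
  show "0 \<le> aw_dist S f g"
    unfolding aw_dist_def set_lebesgue_integral_def
    by (intro integral_nonneg_AE AE_I2) (auto simp: indicator_def aw_dist_rho_nonneg)
next
  fix f g :: "real ^ 'n \<Rightarrow> ereal"
  assume fg: "f \<in> usc_fcns S" "g \<in> usc_fcns S"
  show "aw_dist S f g = 0 \<longleftrightarrow> f = g"
  proof
    assume 0: "aw_dist S f g = 0"
    have gap: "hdist S z f = hdist S z g" if "z \<in> S \<times> UNIV" for z
      using aw_dist_lower[OF fg that] 0 by simp
    have sub: "hypo S h \<subseteq> S \<times> UNIV" for h :: "real ^ 'n \<Rightarrow> ereal" by (auto simp: hypo_def)
    have "z \<in> hypo S f \<longleftrightarrow> z \<in> hypo S g" if "z \<in> S \<times> UNIV" for z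
      using gap[OF that] dist_inf_eq_0_iff[OF usc_fcnsD[OF fg(1)], of z]
        dist_inf_eq_0_iff[OF usc_fcnsD[OF fg(2)], of z] by simp
    then have "hypo S f = hypo S g" using sub[of f] sub[of g] by blast
    then show "f = g" using hypo_eq_imp_eq[OF fg] by blast
  next
    assume "f = g"
    moreover have "aw_dist_rho S \<rho> g g = 0" if "0 \<le> \<rho>" for \<rho>
      using aw_dist_rho_least[OF that, of g g 0] aw_dist_rho_nonneg[OF that, of g g] by simp
    ultimately have "(\<lambda>\<rho>. indicator {0..} \<rho> *\<^sub>R (aw_dist_rho S \<rho> f g * exp (- \<rho>))) = (\<lambda>_. 0)"
      by (auto simp: indicator_def)
    then show "aw_dist S f g = 0"
      unfolding aw_dist_def set_lebesgue_integral_def by simp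
  qed
next
  fix f g h :: "real ^ 'n \<Rightarrow> ereal"
  assume fgh: "f \<in> usc_fcns S" "g \<in> usc_fcns S" "h \<in> usc_fcns S"
  note i = aw_dist_rho_integrable[OF fgh(1,2)] aw_dist_rho_integrable[OF fgh(2,3)]
  have "aw_dist S f h \<le> (LINT \<rho>:{0..}|lborel. aw_dist_rho S \<rho> f g * exp (- \<rho>) + aw_dist_rho S \<rho> g h * exp (- \<rho>))"
    unfolding aw_dist_def
  proof (rule set_integral_mono[OF aw_dist_rho_integrable[OF fgh(1,3)] set_integral_add(1)[OF i]])
    fix \<rho> :: real assume "\<rho> \<in> {0..}"
    then have "0 \<le> \<rho>" by simp
    then have "aw_dist_rho S \<rho> f h \<le> aw_dist_rho S \<rho> f g + aw_dist_rho S \<rho> g h"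
    proof (rule aw_dist_rho_least)
      fix z :: "(real ^ 'n) \<times> real" assume "z \<in> S \<times> UNIV" "infnorm z \<le> \<rho>"
      from aw_dist_rho_upper[OF this, of f g] aw_dist_rho_upper[OF this, of g h]
      show "\<bar>hdist S z f - hdist S z h\<bar> \<le> aw_dist_rho S \<rho> f g + aw_dist_rho S \<rho> g h"
        by linarith
    qed
    then show "aw_dist_rho S \<rho> f h * exp (- \<rho>) \<le> aw_dist_rho S \<rho> f g * exp (- \<rho>) + aw_dist_rho S \<rho> g h * exp (- \<rho>)"
      by (simp add: distrib_right[symmetric])
  qed
  then show "aw_dist S f h \<le> aw_dist S f g + aw_dist S g h"
    by (simp add: aw_dist_def set_integral_add(2)[OF i])
qed

end

section \<open>Completeness, covering numbers and compactness\<close>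

text \<open>The distance functions of a Cauchy sequence converge uniformly on bounded sets by
  \<open>aw_dist_lower\<close>. Their limit \<open>u\<close> is the distance function of its own
  zero set \<open>H\<close>, and \<open>H\<close> is a hypograph; \<open>aw_dist_upper\<close> then
  gives convergence in \<open>aw_dist\<close>.\<close>

lemma mcomplete_usc_fcns:
  fixes S :: "(real ^ 'n) set"
  assumes "closed S" and S0: "0 \<in> S"
  shows "Metric_space.mcomplete (usc_fcns S) (aw_dist S)"
proof -
  interpret Metric_space "usc_fcns S" "aw_dist S" by (rule Metric_space_aw_dist[OF S0])
  have clS: "closed (S \<times> (UNIV::real set))" using assms(1) by (simp add: closed_Times)
  have z0: "(0::(real ^ 'n) \<times> real) \<in> S \<times> UNIV" using S0 by (simp add: zero_prod_def)
  show ?thesis unfolding mcomplete_def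
  proof (intro allI impI)
    fix \<sigma> assume "MCauchy \<sigma>"
    then have usc: "\<And>n. \<sigma> n \<in> usc_fcns S"
      and Cau: "\<And>e. e > 0 \<Longrightarrow> \<exists>N. \<forall>m n. N \<le> m \<longrightarrow> N \<le> n \<longrightarrow> aw_dist S (\<sigma> m) (\<sigma> n) < e"
      unfolding MCauchy_def by auto
    have unif: "\<exists>N. \<forall>m\<ge>N. \<forall>n\<ge>N. \<forall>z\<in>S \<times> UNIV. infnorm z \<le> r \<longrightarrow>
        \<bar>hdist S z (\<sigma> m) - hdist S z (\<sigma> n)\<bar> < e" if e: "0 < e" for e r :: real
    proof -
      obtain N where N: "\<forall>m n. N \<le> m \<longrightarrow> N \<le> n \<longrightarrow> aw_dist S (\<sigma> m) (\<sigma> n) < e * exp (- r)"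
        using Cau[of "e * exp (- r)"] e by auto
      have "\<bar>hdist S z (\<sigma> m) - hdist S z (\<sigma> n)\<bar> < e"
        if "m \<ge> N" "n \<ge> N" "z \<in> S \<times> UNIV" "infnorm z \<le> r" for m n z
      proof -
        have "\<bar>hdist S z (\<sigma> m) - hdist S z (\<sigma> n)\<bar> \<le> exp (infnorm z) * aw_dist S (\<sigma> m) (\<sigma> n)"
          by (rule aw_dist_lower[OF S0 usc usc that(3)])
        also have "\<dots> \<le> exp r * aw_dist S (\<sigma> m) (\<sigma> n)"
          using that(4) by (intro mult_right_mono) auto
        also have "\<dots> < exp r * (e * exp (- r))" using N that by simp
        also have "\<dots> = e" by (simp add: exp_minus)
        finally show ?thesis .
      qed
      then show ?thesis by blast
    qed
    define u where "u z = lim (\<lambda>n. hdist S z (\<sigma> n))" for z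
    have u: "(\<lambda>n. hdist S z (\<sigma> n)) \<longlonglongrightarrow> u z" if "z \<in> S \<times> UNIV" for z
    proof -
      have "Cauchy (\<lambda>n. hdist S z (\<sigma> n))"
        using unif[of _ "infnorm z"] that by (intro CauchyI) (metis order_refl real_norm_def)
      then show ?thesis unfolding u_def by (simp add: Cauchy_convergent_iff convergent_LIMSEQ_iff)
    qed
    have u_nonneg: "0 \<le> u z" if "z \<in> S \<times> UNIV" for z
      by (rule LIMSEQ_le_const[OF u[OF that]]) (auto intro: hdist_nonneg usc)
    have u_lip: "u z \<le> infnorm (z - w) + u w" if "z \<in> S \<times> UNIV" "w \<in> S \<times> UNIV" for z w
      by (rule LIMSEQ_le[OF u[OF that(1)] tendsto_add[OF tendsto_const u[OF that(2)]]])
        (auto intro!: dist_inf_triangle)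
    \<comment> \<open>Shifting a hypograph downwards maps it into itself, so the distance from a
      point cannot grow when the point is lowered. In the limit this makes \<open>H\<close> closed
      under lowering, as a hypograph must be.\<close>
    have u_down: "u (x, b) \<le> u (x, a)" if "x \<in> S" "b \<le> a" for x a b
    proof (rule LIMSEQ_le[OF u u])
      have "hdist S (x, b) (\<sigma> n) \<le> hdist S (x, a) (\<sigma> n)" for n
      proof (rule dist_inf_greatest)
        fix w assume w: "w \<in> hypo S (\<sigma> n)"
        obtain y c where [simp]: "w = (y, c)" by fastforce
        have "(y, c - (a - b)) \<in> hypo S (\<sigma> n)"
          using w that by (auto simp: hypo_def intro: order_trans[of _ "ereal c"])
        from dist_inf_le[OF this, of "(x, b)"]
        show "hdist S (x, b) (\<sigma> n) \<le> infnorm ((x, a) - w)" by (simp add: algebra_simps)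
      qed (use usc usc_fcnsD in auto)
      then show "\<exists>N. \<forall>n\<ge>N. hdist S (x, b) (\<sigma> n) \<le> hdist S (x, a) (\<sigma> n)" by blast
    qed (use that in auto)
    define H where "H = {z \<in> S \<times> UNIV. u z = 0}"
    \<comment> \<open>Almost closest points of the hypographs of \<open>\<sigma> n\<close> stay
      bounded, and a subsequential limit of them is a point of \<open>H\<close> at distance at most
      \<open>u z\<close>. This also shows that \<open>H\<close> is nonempty.\<close>
    have near: "\<exists>h\<in>H. infnorm (z - h) \<le> u z" if z: "z \<in> S \<times> UNIV" for z
    proof -
      have "\<exists>w\<in>hypo S (\<sigma> n). infnorm (z - w) < hdist S z (\<sigma> n) + inverse (Suc n)" for n
        using dist_inf_nearE[OF usc_fcnsD(1)[OF usc[of n]], of "inverse (Suc n)" z] by auto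
      then obtain w where w: "\<And>n. w n \<in> hypo S (\<sigma> n)"
        "\<And>n. infnorm (z - w n) < hdist S z (\<sigma> n) + inverse (Suc n)" by metis
      have lim: "(\<lambda>n. hdist S z (\<sigma> n) + inverse (Suc n)) \<longlonglongrightarrow> u z"
        using tendsto_add[OF u[OF z] LIMSEQ_inverse_real_of_nat] by simp
      then have "Bseq (\<lambda>n. hdist S z (\<sigma> n) + inverse (Suc n))"
        by (intro convergent_imp_Bseq convergentI)
      then obtain B where B: "\<forall>n. norm (hdist S z (\<sigma> n) + inverse (Suc n)) \<le> B"
        by (rule BseqE)
      have "norm (w n) \<le> sqrt DIM((real ^ 'n) \<times> real) * (infnorm z + B)" for n
      proof -
        have "infnorm (w n) \<le> infnorm z + infnorm (z - w n)"
          using infnorm_triangle[of z "w n - z"] infnorm_sub[of z "w n"] by simp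
        also have "\<dots> \<le> infnorm z + B" using w(2)[of n] spec[OF B, of n] by simp
        finally show ?thesis using norm_le_infnorm[of "w n"]
          by (meson mult_left_mono order_trans real_sqrt_ge_zero of_nat_0_le_iff)
      qed
      then have "bounded (range w)" by (auto simp: bounded_iff)
      then obtain l r where lr: "strict_mono r" "(w \<circ> r) \<longlonglongrightarrow> l"
        using bounded_imp_convergent_subsequence by blast
      have "w (r n) \<in> S \<times> UNIV" for n using w(1)[of "r n"] by (auto simp: hypo_def)
      then have l: "l \<in> S \<times> UNIV" using closed_sequentially[OF clS _ lr(2)] by simp
      have wl: "(\<lambda>n. infnorm (y - w (r n))) \<longlonglongrightarrow> infnorm (y - l)" for y
        using lr(2) unfolding o_def by (intro tendsto_infnorm tendsto_diff tendsto_const)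
      have "u l \<le> infnorm (l - l)"
      proof (rule LIMSEQ_le[OF LIMSEQ_subseq_LIMSEQ[OF u[OF l] lr(1)] wl])
        show "\<exists>N. \<forall>n\<ge>N. ((\<lambda>n. hdist S l (\<sigma> n)) \<circ> r) n \<le> infnorm (l - w (r n))"
          by (auto intro!: dist_inf_le w(1))
      qed
      then have "u l = 0" using u_nonneg[OF l] by (simp add: infnorm_0)
      moreover have "infnorm (z - l) \<le> u z"
      proof (rule LIMSEQ_le[OF wl LIMSEQ_subseq_LIMSEQ[OF lim lr(1)]])
        show "\<exists>N. \<forall>n\<ge>N. infnorm (z - w (r n)) \<le> ((\<lambda>n. hdist S z (\<sigma> n) + inverse (Suc n)) \<circ> r) n"
          using w(2) by (auto intro!: less_imp_le)
      qed
      ultimately show ?thesis using l by (auto simp: H_def)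
    qed
    have "closed H"
    proof (rule closed_sequential_limits[THEN iffD2], intro allI impI, elim conjE)
      fix w l assume w: "\<forall>n. w n \<in> H" "w \<longlonglongrightarrow> l"
      then have l: "l \<in> S \<times> UNIV" using closed_sequentially[OF clS _ w(2)] by (auto simp: H_def)
      have "u l \<le> infnorm (l - l)"
      proof (rule LIMSEQ_le_const)
        show "(\<lambda>n. infnorm (l - w n)) \<longlonglongrightarrow> infnorm (l - l)" by (intro tendsto_infnorm tendsto_diff tendsto_const w(2))
        show "\<exists>N. \<forall>n\<ge>N. u l \<le> infnorm (l - w n)"
          using u_lip[OF l, of "w _"] w(1) by (force simp: H_def)
      qed
      then show "l \<in> H" using u_nonneg[OF l] l by (simp add: infnorm_0 H_def)
    qed
    \<comment> \<open>Over a point where \<open>H\<close> has no height the supremum is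
      \<open>- \<infinity>\<close>.\<close>
    define f where "f = (\<lambda>x\<in>S. Sup {ereal a |a. u (x, a) = 0})"
    have "ereal a \<le> f x \<longleftrightarrow> u (x, a) = 0" if x: "x \<in> S" for x a
    proof
      assume "u (x, a) = 0"
      then show "ereal a \<le> f x" using x by (auto simp: f_def intro!: Sup_upper)
    next
      assume a: "ereal a \<le> f x"
      \<comment> \<open>Whether the supremum is attained is not yet known: some height above
        \<open>a - e\<close> belongs to \<open>H\<close>, hence so does \<open>a - e\<close> by
        \<open>u_down\<close>, and climbing back to \<open>a\<close> raises the distance by at most
        \<open>e\<close>.\<close>
      have "u (x, a) \<le> 0 + e" if "0 < e" for e
      proof -
        have "ereal (a - e) < ereal a" using that by simp
        also note a
        finally obtain b where b: "a - e < b" "u (x, b) = 0"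
          using x by (auto simp: f_def less_Sup_iff)
        have "u (x, a - e) \<le> 0" using u_down[OF x, of "a - e" b] b by simp
        moreover have "u (x, a) \<le> infnorm ((x, a) - (x, a - e)) + u (x, a - e)"
          by (rule u_lip) (use x in auto)
        moreover have "infnorm ((x, a) - (x, a - e)) \<le> e"
          using that by (simp add: infnorm_Pair_le_iff)
        ultimately show ?thesis by linarith
      qed
      then have "u (x, a) \<le> 0" by (rule field_le_epsilon)
      then show "u (x, a) = 0" using u_nonneg[of "(x, a)"] x by simp
    qed
    then have hypo_f: "hypo S f = H" by (auto simp: hypo_def H_def)
    have "H \<noteq> {}" using near[OF z0] by blast
    then have f: "f \<in> usc_fcns S"
      using \<open>closed H\<close> hypo_f by (auto simp: usc_fcns_def f_def)
    have hf: "hdist S z f = u z" if z: "z \<in> S \<times> UNIV" for z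
    proof (rule antisym)
      obtain h where "h \<in> H" "infnorm (z - h) \<le> u z" using near[OF z] by blast
      then show "hdist S z f \<le> u z" using dist_inf_le[of h H z] by (simp add: hypo_f)
      show "u z \<le> hdist S z f" unfolding hypo_f
      proof (rule dist_inf_greatest[OF \<open>H \<noteq> {}\<close>])
        fix h assume "h \<in> H"
        then show "u z \<le> infnorm (z - h)" using u_lip[OF z, of h] by (simp add: H_def)
      qed
    qed
    obtain R where R: "0 < R" "\<forall>n. norm (hdist S 0 (\<sigma> n)) \<le> R"
      by (rule BseqE[OF convergent_imp_Bseq[OF convergentI[OF u[OF z0]]]])
    have "\<exists>N. \<forall>n\<ge>N. aw_dist S (\<sigma> n) f < e" if e: "0 < e" for e
    proof -
      define c where "c = 4 * (4 + (R + u 0))"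
      have c: "0 < c" using R u_nonneg[OF z0] by (simp add: c_def)
      \<comment> \<open>From this radius on the tail term of \<open>aw_dist_upper\<close> is at most
        \<open>e / 2\<close>.\<close>
      define r where "r = max 0 (2 * ln (2 * c / e))"
      have "c * exp (- r / 2) \<le> c * exp (- ln (2 * c / e))" using c by (intro mult_left_mono) (auto simp: r_def)
      also have "\<dots> = e / 2" using c e by (simp add: exp_minus)
      finally have cr: "c * exp (- r / 2) \<le> e / 2" .
      obtain N where N: "\<forall>m\<ge>N. \<forall>n\<ge>N. \<forall>z\<in>S \<times> UNIV. infnorm z \<le> r \<longrightarrow>
        \<bar>hdist S z (\<sigma> m) - hdist S z (\<sigma> n)\<bar> < e / 4" using unif[of "e/4" r] e by auto
      have "aw_dist S (\<sigma> n) f < e" if "n \<ge> N" for n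
      proof -
        have "aw_dist S (\<sigma> n) f \<le> e / 4 + 4 * (4 + (R + u 0)) * exp (- r / 2)"
        proof (rule aw_dist_upper[OF S0 usc f])
          show "hdist S 0 (\<sigma> n) + hdist S 0 f \<le> R + u 0" using spec[OF R(2), of n] hf[OF z0] by simp
          fix z :: "(real ^ 'n) \<times> real" assume z: "z \<in> S \<times> UNIV" "infnorm z \<le> r"
          show "\<bar>hdist S z (\<sigma> n) - hdist S z f\<bar> \<le> e / 4" unfolding hf[OF z(1)]
          proof (rule LIMSEQ_le_const2)
            show "(\<lambda>m. \<bar>hdist S z (\<sigma> n) - hdist S z (\<sigma> m)\<bar>) \<longlonglongrightarrow> \<bar>hdist S z (\<sigma> n) - u z\<bar>"
              by (intro tendsto_intros u z)
            show "\<exists>M. \<forall>m\<ge>M. \<bar>hdist S z (\<sigma> n) - hdist S z (\<sigma> m)\<bar> \<le> e / 4"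
              using N z that by (meson less_imp_le)
          qed
        qed (use e in \<open>auto simp: r_def\<close>)
        then show ?thesis using cr e by (simp add: c_def)
      qed
      then show ?thesis by blast
    qed
    then have "limitin mtopology \<sigma> f sequentially"
      unfolding limit_metric_sequentially using f usc by blast
    then show "\<exists>x. limitin mtopology \<sigma> x sequentially" by blast
  qed
qed

text \<open>At the origin the exponential factor of \<open>aw_dist_lower\<close> is 1.\<close>

lemma mbounded_usc_fcns_imp_hdist_le:
  fixes S :: "(real ^ 'n) set"
  assumes S0: "0 \<in> S" and F: "F \<subseteq> usc_fcns S" "Metric_space.mbounded (usc_fcns S) (aw_dist S) F"
  obtains R where "0 \<le> R" "\<And>f. f \<in> F \<Longrightarrow> hdist S 0 f \<le> R"
proof -
  interpret Metric_space "usc_fcns S" "aw_dist S" by (rule Metric_space_aw_dist[OF S0])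
  obtain g B where gB: "F \<subseteq> mcball g B" using F(2) unfolding mbounded_def by blast
  have z0: "(0::(real ^ 'n) \<times> real) \<in> S \<times> UNIV" using S0 by (simp add: zero_prod_def)
  show ?thesis
  proof (rule that)
    fix f assume "f \<in> F"
    then have "g \<in> usc_fcns S" "f \<in> usc_fcns S" "aw_dist S g f \<le> B" using gB by auto
    then show "hdist S 0 f \<le> \<bar>hdist S 0 g\<bar> + \<bar>B\<bar>"
      using aw_dist_lower[OF S0 _ _ z0, of g f] by (simp add: infnorm_0)
  qed simp
qed

section \<open>Grid codes of hypographs and covering numbers\<close>

definition cell :: "real \<Rightarrow> (real ^ 'n) \<times> real \<Rightarrow> ('n \<Rightarrow> int) \<times> int" where
  "cell \<delta> z = (\<lambda>j. \<lfloor>fst z $ j / \<delta>\<rfloor>, \<lfloor>snd z / \<delta>\<rfloor>)"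

text \<open>The top occupied cell of each column of the grid inside the box, and \<open>- K - 1\<close> for columns
  which the hypograph does not meet.\<close>

definition hypo_code :: "(real ^ 'n) set \<Rightarrow> real \<Rightarrow> int \<Rightarrow> (real ^ 'n \<Rightarrow> ereal) \<Rightarrow> ('n \<Rightarrow> int) \<Rightarrow> int" where
  "hypo_code S \<delta> K f = (\<lambda>i\<in>UNIV \<rightarrow>\<^sub>E {- K..K}.
     Max (insert (- K - 1) {k \<in> {- K..K}. (i, k) \<in> cell \<delta> ` hypo S f}))"

text \<open>This range makes the codes countable in the elementary sense: \<open>2 * K + 2\<close>
  possible tops over each of \<open>(2 * K + 1) ^ n\<close> columns, where
  \<open>n = CARD('n)\<close>.\<close>

lemma hypo_code_in:
  assumes "0 \<le> K"
  shows "hypo_code S \<delta> K f \<in> (UNIV \<rightarrow>\<^sub>E {- K..K}) \<rightarrow>\<^sub>E {- K - 1..K}"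
proof (rule PiE_I)
  fix i :: "'a \<Rightarrow> int" assume i: "i \<in> UNIV \<rightarrow>\<^sub>E {- K..K}"
  let ?A = "insert (- K - 1) {k \<in> {- K..K}. (i, k) \<in> cell \<delta> ` hypo S f}"
  have "finite ?A" by (rule finite_subset[of _ "{- K - 1..K}"]) (use assms in auto)
  then have "Max ?A \<in> ?A" by (intro Max_in) auto
  then show "hypo_code S \<delta> K f i \<in> {- K - 1..K}"
    using i assms by (auto simp: hypo_code_def)
qed (simp add: hypo_code_def)

lemma abs_diff_le_of_floor_eq:
  fixes a b \<delta> :: real
  assumes "0 < \<delta>" "\<lfloor>a / \<delta>\<rfloor> = \<lfloor>b / \<delta>\<rfloor>"
  shows "\<bar>a - b\<bar> \<le> \<delta>"
proof -
  have "\<bar>a / \<delta> - b / \<delta>\<bar> \<le> 1" using assms(2) by linarith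
  then have "\<bar>a - b\<bar> / \<delta> \<le> 1" using assms(1) by (simp add: diff_divide_distrib[symmetric])
  then show ?thesis using assms(1) by (simp add: field_simps)
qed

lemma floor_divide_bounds:
  fixes a \<delta> :: real
  assumes "0 < \<delta>" "\<bar>a\<bar> \<le> of_int K * \<delta>"
  shows "\<lfloor>a / \<delta>\<rfloor> \<in> {- K..K}"
proof -
  have "a \<le> of_int K * \<delta>" "- (of_int K * \<delta>) \<le> a" using assms(2) by linarith+
  then have "a / \<delta> \<le> of_int K" "- of_int K \<le> a / \<delta>" using assms(1) by (simp_all add: field_simps)
  then show ?thesis by (simp add: le_floor_iff floor_le_iff)
qed

text \<open>Hypographs are closed under lowering, so the top cell of a column represents the whole
  column. A point of \<open>hypo S g\<close> in the top cell of the column of \<open>w\<close> is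
  either above \<open>w\<close>, and is lowered to the height of \<open>w\<close>, or below it, and
  then both lie in the same cell.\<close>

lemma hypo_code_eq_near:
  fixes S :: "(real ^ 'n) set"
  assumes \<delta>: "0 < \<delta>" and eq: "hypo_code S \<delta> K f = hypo_code S \<delta> K g"
    and w: "w \<in> hypo S f" "infnorm w \<le> of_int K * \<delta>"
  obtains w' where "w' \<in> hypo S g" "infnorm (w - w') \<le> \<delta>"
proof -
  obtain x a where xa: "w = (x, a)" by fastforce
  have le: "\<bar>x $ j\<bar> \<le> of_int K * \<delta>" "\<bar>a\<bar> \<le> of_int K * \<delta>" for j
    using w(2) by (auto simp: xa infnorm_Pair_le_iff)
  define i k where "i = fst (cell \<delta> w)" and "k = snd (cell \<delta> w)"
  have i: "i \<in> UNIV \<rightarrow>\<^sub>E {- K..K}"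
    using floor_divide_bounds[OF \<delta> le(1)] by (auto simp: i_def cell_def xa)
  have k: "k \<in> {- K..K}"
    using floor_divide_bounds[OF \<delta> le(2)] by (auto simp: k_def cell_def xa)
  define A where "A h = insert (- K - 1) {k \<in> {- K..K}. (i, k) \<in> cell \<delta> ` hypo S h}" for h
  have fin: "finite (A h)" for h
    by (rule finite_subset[of _ "insert (- K - 1) {- K..K}"]) (auto simp: A_def)
  have "(i, k) \<in> cell \<delta> ` hypo S f" using w(1) by (auto simp: i_def k_def)
  then have "k \<le> Max (A f)" using k by (intro Max_ge fin) (auto simp: A_def)
  also have "Max (A f) = Max (A g)"
    using fun_cong[OF eq, of i] i by (simp add: hypo_code_def A_def)
  finally have kle: "k \<le> Max (A g)" .
  have "Max (A g) \<in> A g" by (intro Max_in fin) (auto simp: A_def)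
  \<comment> \<open>\<open>k\<close> is at least \<open>- K\<close>, which rules out the default
    value \<open>- K - 1\<close>: the maximum is the level of a cell that \<open>hypo S g\<close>
    meets.\<close>
  then have "(i, Max (A g)) \<in> cell \<delta> ` hypo S g" using kle k by (auto simp: A_def)
  then obtain y b where yb: "(y, b) \<in> hypo S g" "cell \<delta> (y, b) = (i, Max (A g))" by fastforce
  have x: "\<bar>x $ j - y $ j\<bar> \<le> \<delta>" for j
    using yb(2) by (intro abs_diff_le_of_floor_eq[OF \<delta>]) (auto simp: i_def cell_def xa fun_eq_iff)
  have "(y, min a b) \<in> hypo S g"
    using yb(1) by (auto simp: hypo_def intro: order_trans[of _ "ereal b"])
  moreover have "\<bar>a - min a b\<bar> \<le> \<delta>"
  proof (cases "a \<le> b")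
    case False
    have "\<lfloor>b / \<delta>\<rfloor> = Max (A g)" using yb(2) by (simp add: cell_def)
    moreover have "\<lfloor>b / \<delta>\<rfloor> \<le> \<lfloor>a / \<delta>\<rfloor>"
      using False \<delta> by (intro floor_mono divide_right_mono) auto
    moreover have "k = \<lfloor>a / \<delta>\<rfloor>" by (simp add: k_def cell_def xa)
    ultimately have "\<lfloor>a / \<delta>\<rfloor> = \<lfloor>b / \<delta>\<rfloor>" using kle by linarith
    from abs_diff_le_of_floor_eq[OF \<delta> this] False show ?thesis by simp
  qed (use \<delta> in simp)
  ultimately show ?thesis using x by (intro that[of "(y, min a b)"]) (auto simp: xa infnorm_Pair_le_iff)
qed

text \<open>An almost closest point to \<open>z\<close> has norm below
  \<open>r + (r + R) + 1\<close>: the norm of \<open>z\<close>, its distance to the hypograph, and a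
  slack of at most 1. So it lies in the box that the code describes.\<close>

lemma hypo_code_eq_hdist_le:
  fixes S :: "(real ^ 'n) set"
  assumes \<delta>: "0 < \<delta>" and eq: "hypo_code S \<delta> K f = hypo_code S \<delta> K g"
    and f: "f \<in> usc_fcns S" "hdist S 0 f \<le> R" and K: "2 * r + R + 1 \<le> of_int K * \<delta>"
    and z: "infnorm z \<le> r"
  shows "hdist S z g \<le> hdist S z f + \<delta>"
proof (rule field_le_epsilon)
  fix e :: real assume e: "0 < e"
  obtain w where w: "w \<in> hypo S f" "infnorm (z - w) < hdist S z f + min e 1"
    using dist_inf_nearE[OF usc_fcnsD(1)[OF f(1)], of "min e 1" z] e by auto
  have "infnorm w \<le> infnorm z + infnorm (z - w)"
    using infnorm_triangle[of z "w - z"] infnorm_sub[of z w] by simp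
  also have "\<dots> \<le> of_int K * \<delta>"
    using w(2) z K f(2) hdist_le[of z S f] by linarith
  finally obtain w' where w': "w' \<in> hypo S g" "infnorm (w - w') \<le> \<delta>"
    using hypo_code_eq_near[OF \<delta> eq w(1)] by blast
  have "hdist S z g \<le> infnorm (z - w')" by (rule dist_inf_le[OF w'(1)])
  also have "\<dots> \<le> infnorm (z - w) + infnorm (w - w')" by (rule infnorm_triangle_diff)
  finally show "hdist S z g \<le> hdist S z f + \<delta> + e" using w(2) w'(2) by linarith
qed

text \<open>Functions with equal codes are at distance of order \<delta>, so it suffices to count
  codes. Letting the box grow like \<open>L = ln (1 / \<delta>)\<close> costs only logarithms:
  \<open>(A * L / \<delta>) ^ n\<close> bounds the number of columns, and one more factor
  \<open>L\<close> comes from the logarithm of the number of levels.\<close>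

lemma usc_fcns_covering:
  fixes S :: "(real ^ 'n) set"
  assumes S0: "0 \<in> S" and F: "F \<subseteq> usc_fcns S" and R: "0 \<le> R" "\<And>f. f \<in> F \<Longrightarrow> hdist S 0 f \<le> R"
  shows "\<exists>q>0. \<exists>C\<ge>0. \<forall>\<delta>. 0 < \<delta> \<longrightarrow> \<delta> \<le> exp (- 1) \<longrightarrow>
    (\<exists>G. finite G \<and> G \<subseteq> F \<and> (\<forall>f\<in>F. \<exists>g\<in>G. aw_dist S f g \<le> q * \<delta>) \<and>
      real (card G) \<le> exp (C * ln (1 / \<delta>) ^ (CARD('n) + 1) / \<delta> ^ CARD('n)))"
proof -
  define n where "n = CARD('n)"
  \<comment> \<open>Chosen for \<open>2 * K + 2 \<le> A * L / \<delta>\<close>: the rounded box size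
    gives \<open>8 * L + 2 * R + 2 + 4 * \<delta>\<close>, and
    \<open>\<delta> \<le> 1 \<le> L\<close> turns the constants into multiples of
    \<open>L\<close>.\<close>
  define A where "A = 14 + 2 * R"
  define q where "q = 1 + 4 * (4 + 2 * R)"
  define C where "C = A ^ n * (ln A + 2)"
  have A: "1 \<le> A" using R by (simp add: A_def)
  have "\<exists>G. finite G \<and> G \<subseteq> F \<and> (\<forall>f\<in>F. \<exists>g\<in>G. aw_dist S f g \<le> q * \<delta>) \<and>
      real (card G) \<le> exp (C * ln (1 / \<delta>) ^ (n + 1) / \<delta> ^ n)"
    if \<delta>: "0 < \<delta>" and \<delta>1: "\<delta> \<le> exp (- 1)" for \<delta> :: real
  proof -
    define L where "L = ln (1 / \<delta>)"
    have eL: "exp (- L) = \<delta>" using \<delta> by (simp add: L_def ln_div)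
    have L: "1 \<le> L" using \<delta> \<delta>1 eL by (metis exp_le_cancel_iff neg_le_iff_le)
    have \<delta>le: "\<delta> \<le> 1" using eL L by (metis exp_le_one_iff neg_le_0_iff_le order_trans zero_le_one)
    define K where "K = \<lceil>(4 * L + R + 1) / \<delta>\<rceil>"
    have "0 \<le> (4 * L + R + 1) / \<delta>" using L R \<delta> by simp
    then have K0: "0 \<le> K" unfolding K_def by linarith
    have Kge: "4 * L + R + 1 \<le> of_int K * \<delta>"
      using le_of_int_ceiling[of "(4 * L + R + 1) / \<delta>"] \<delta> by (simp only: K_def pos_divide_le_eq)
    have Kle: "2 * real_of_int K + 2 \<le> A * L / \<delta>"
    proof -
      have "real_of_int K \<le> (4 * L + R + 1) / \<delta> + 1" unfolding K_def by linarith
      then have "2 * real_of_int K + 2 \<le> 2 * ((4 * L + R + 1) / \<delta> + 1) + 2"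
        by (intro add_right_mono mult_left_mono) auto
      also have "\<dots> = (8 * L + 2 * R + 2 + 4 * \<delta>) / \<delta>" using \<delta> by (simp add: field_simps)
      also have "\<dots> \<le> (8 * L + (2 * R + 2 + 4) * L) / \<delta>"
      proof (rule divide_right_mono)
        have "(2 * R + 2 + 4) * 1 \<le> (2 * R + 2 + 4) * L" using L R by (intro mult_left_mono) auto
        then show "8 * L + 2 * R + 2 + 4 * \<delta> \<le> 8 * L + (2 * R + 2 + 4) * L"
          using \<delta>le by (simp add: algebra_simps)
      qed (use \<delta> in simp)
      also have "8 * L + (2 * R + 2 + 4) * L = A * L" by (simp add: A_def algebra_simps)
      finally show ?thesis .
    qed
    define code where "code = hypo_code S \<delta> K"
    define T where "T = ((UNIV :: 'n set) \<rightarrow>\<^sub>E {- K..K}) \<rightarrow>\<^sub>E {- K - 1..K}"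
    have finT: "finite T" unfolding T_def by (intro finite_PiE) auto
    have codeT: "code ` F \<subseteq> T" unfolding code_def T_def by (intro image_subsetI hypo_code_in K0)
    \<comment> \<open>One member of \<open>F\<close> for each code that occurs in \<open>F\<close>,
      so that the centres of the net lie where the integrand is controlled.\<close>
    define G where "G = (\<lambda>c. SOME f. f \<in> F \<and> code f = c) ` code ` F"
    have some: "(SOME h. h \<in> F \<and> code h = code f) \<in> F \<and> code (SOME h. h \<in> F \<and> code h = code f) = code f"
      if "f \<in> F" for f
      by (rule someI[of _ f]) (use that in auto)
    have finG: "finite G" unfolding G_def by (intro finite_imageI finite_subset[OF codeT finT])
    have GF: "G \<subseteq> F" unfolding G_def using some by blast
    have cover: "\<exists>g\<in>G. aw_dist S f g \<le> q * \<delta>" if f: "f \<in> F" for f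
    proof -
      define g where "g = (SOME h. h \<in> F \<and> code h = code f)"
      have g: "g \<in> F" "code f = code g" using some[OF f] by (auto simp: g_def)
      have "g \<in> G" unfolding G_def g_def using f by blast
      \<comment> \<open>Radius \<open>2 * L\<close> turns the tail factor into
        \<open>exp (- L) = \<delta>\<close>, the size of the mesh.\<close>
      moreover have "aw_dist S f g \<le> \<delta> + 4 * (4 + 2 * R) * exp (- (2 * L) / 2)"
      proof (rule aw_dist_upper[OF S0])
        show "f \<in> usc_fcns S" "g \<in> usc_fcns S" using f g F by auto
        show "hdist S 0 f + hdist S 0 g \<le> 2 * R" using R(2)[OF f] R(2)[OF g(1)] by simp
        fix z :: "(real ^ 'n) \<times> real" assume z: "infnorm z \<le> 2 * L"
        have K': "2 * (2 * L) + R + 1 \<le> of_int K * \<delta>" using Kge by simp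
        have "hdist S z g \<le> hdist S z f + \<delta>"
          by (rule hypo_code_eq_hdist_le[OF \<delta> g(2)[unfolded code_def] _ R(2)[OF f] K' z]) (use f F in auto)
        moreover have "hdist S z f \<le> hdist S z g + \<delta>"
          by (rule hypo_code_eq_hdist_le[OF \<delta> g(2)[symmetric, unfolded code_def] _ R(2)[OF g(1)] K' z])
            (use g F in auto)
        ultimately show "\<bar>hdist S z f - hdist S z g\<bar> \<le> \<delta>" by linarith
      qed (use \<delta> L in auto)
      then have "aw_dist S f g \<le> q * \<delta>" using eL by (simp add: q_def algebra_simps)
      ultimately show ?thesis by blast
    qed
    define a b where "a = nat (2 * K + 1)" and "b = nat (2 * K + 2)"
    have ab: "1 \<le> b" "real a \<le> A * L / \<delta>" "real b \<le> A * L / \<delta>"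
      using Kle K0 by (auto simp: a_def b_def)
    have "card G \<le> card T"
      unfolding G_def
      by (rule order_trans[OF card_image_le card_mono[OF finT codeT]])
        (use finite_subset[OF codeT finT] in auto)
    also have "card T = b ^ (a ^ n)"
      unfolding T_def by (subst card_funcsetE, intro finite_PiE, auto simp: card_funcsetE a_def b_def n_def)
        (simp add: algebra_simps)
    finally have "real (card G) \<le> real b ^ (a ^ n)" by (metis of_nat_le_iff of_nat_power)
    also have "\<dots> = exp (real (a ^ n) * ln (real b))"
      using ab(1) by (subst exp_of_nat_mult, subst exp_ln) auto
    also have "\<dots> \<le> exp ((A * L / \<delta>) ^ n * ((ln A + 2) * L))"
    proof -
      have "real (a ^ n) \<le> (A * L / \<delta>) ^ n" using ab(2) by (simp add: power_mono)
      moreover have "ln (real b) \<le> (ln A + 2) * L"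
      proof -
        have "ln (real b) \<le> ln (A * L / \<delta>)"
          using ab by (subst ln_le_cancel_iff) (auto intro: less_le_trans[of 0 "real b"])
        also have "\<dots> = ln A + ln L + L"
        proof -
          have "ln (A * L / \<delta>) = ln A + ln L - ln \<delta>" using A L \<delta> by (simp add: ln_mult ln_div)
          also have "ln \<delta> = - L" using \<delta> by (simp add: L_def ln_div)
          finally show ?thesis by simp
        qed
        also have "\<dots> \<le> ln A * L + L + L"
          using A L ln_le_minus_one[of L] mult_left_mono[of 1 L "ln A"] by simp
        finally show ?thesis by (simp add: algebra_simps)
      qed
      moreover have "0 \<le> ln (real b)" using ab(1) by simp
      ultimately have "real (a ^ n) * ln (real b) \<le> (A * L / \<delta>) ^ n * ((ln A + 2) * L)"
        using A L \<delta> by (intro mult_mono) auto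
      then show ?thesis by simp
    qed
    also have "(A * L / \<delta>) ^ n * ((ln A + 2) * L) = C * L ^ (n + 1) / \<delta> ^ n"
      by (simp add: C_def power_mult_distrib power_divide)
    finally show ?thesis using finG GF cover unfolding L_def by blast
  qed
  moreover have "0 < q" "0 \<le> C" using A R by (auto simp: q_def C_def)
  ultimately show ?thesis unfolding n_def by blast
qed

section \<open>From covering numbers to compactness\<close>

lemma covering_imp_mtotally_bounded:
  fixes N :: "real \<Rightarrow> real"
  assumes "Metric_space M d" "F \<subseteq> M" "0 < q" "0 < \<delta>0"
    and "\<forall>\<delta>. 0 < \<delta> \<longrightarrow> \<delta> \<le> \<delta>0 \<longrightarrow> (\<exists>G. finite G \<and> G \<subseteq> F \<and> (\<forall>f\<in>F. \<exists>g\<in>G. d f g \<le> q * \<delta>) \<and>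
      real (card G) \<le> N \<delta>)"
  shows "Metric_space.mtotally_bounded M d F"
proof -
  interpret Metric_space M d by fact
  show ?thesis unfolding mtotally_bounded_def
  proof (intro allI impI)
    fix e :: real assume e: "0 < e"
    define \<delta> where "\<delta> = min \<delta>0 (e / (2 * q))"
    have "q * \<delta> \<le> q * (e / (2 * q))" using assms(3) by (intro mult_left_mono) (auto simp: \<delta>_def)
    also have "\<dots> < e" using assms(3) e by simp
    finally have qe: "q * \<delta> < e" .
    obtain G where G: "finite G" "G \<subseteq> F" "\<forall>f\<in>F. \<exists>g\<in>G. d f g \<le> q * \<delta>"
      using assms(3,4,5) e by (metis \<delta>_def min.cobounded1 min_less_iff_conj mult_pos_pos zero_less_divide_iff zero_less_numeral)
    have "F \<subseteq> (\<Union>x\<in>G. mball x e)"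
    proof
      fix f assume f: "f \<in> F"
      then obtain g where "g \<in> G" "d f g \<le> q * \<delta>" using G(3) by blast
      then show "f \<in> (\<Union>x\<in>G. mball x e)"
        using f G(2) assms(2) qe commute[of f g] by (intro UN_I[of g]) auto
    qed
    then show "\<exists>K. finite K \<and> K \<subseteq> F \<and> F \<subseteq> (\<Union>x\<in>K. mball x e)" using G by blast
  qed
qed

lemma compactin_of_mcomplete_mtotally_bounded:
  assumes "Metric_space M d" "Metric_space.mcomplete M d" "Metric_space.mtotally_bounded M d F"
    "closedin (Metric_space.mtopology M d) F"
  shows "compactin (Metric_space.mtopology M d) F"
proof -
  interpret Metric_space M d by fact
  show ?thesis unfolding compactin_sequentially
  proof (intro conjI allI impI)
    show "F \<subseteq> M" using assms(3) mtotally_bounded_imp_subset by blast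
    fix \<sigma> :: "nat \<Rightarrow> 'a" assume \<sigma>: "range \<sigma> \<subseteq> F"
    then obtain r where r: "strict_mono r" "MCauchy (\<sigma> \<circ> r)"
      using assms(3) unfolding mtotally_bounded_sequentially by blast
    then obtain l where l: "limitin mtopology (\<sigma> \<circ> r) l sequentially"
      using assms(2) unfolding mcomplete_def by blast
    have "range (\<sigma> \<circ> r) \<subseteq> F" using \<sigma> by auto
    then have "l \<in> F" using assms(4) l unfolding metric_closedin_iff_sequentially_closed by blast
    then show "\<exists>l r. l \<in> F \<and> strict_mono r \<and> limitin mtopology (\<sigma> \<circ> r) l sequentially"
      using r l by blast
  qed
qed

section \<open>Near-minimizers on compact sets\<close>

lemma (in Metric_space) mtotally_bounded_imp_countable_dense:
  assumes "mtotally_bounded C"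
  obtains D where "countable D" "D \<subseteq> C" "\<And>f e. f \<in> C \<Longrightarrow> 0 < e \<Longrightarrow> \<exists>g\<in>D. d f g < e"
proof -
  have "\<exists>K. finite K \<and> K \<subseteq> C \<and> C \<subseteq> (\<Union>x\<in>K. mball x (inverse (Suc n)))" for n
    using assms unfolding mtotally_bounded_def by auto
  then obtain K where K: "\<And>n. finite (K n)" "\<And>n. K n \<subseteq> C" "\<And>n. C \<subseteq> (\<Union>x\<in>K n. mball x (inverse (Suc n)))"
    by metis
  show thesis
  proof (rule that[of "\<Union>n. K n"])
    show "countable (\<Union>n. K n)" using K(1) by (auto intro: countable_finite)
    show "(\<Union>n. K n) \<subseteq> C" using K(2) by blast
    fix f and e :: real assume "f \<in> C" "0 < e"
    obtain n where n: "inverse (Suc n) < e" using reals_Archimedean[OF \<open>0 < e\<close>] by blast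
    obtain g where "g \<in> K n" "f \<in> mball g (inverse (Suc n))" using K(3)[of n] \<open>f \<in> C\<close> by blast
    then have "d f g < e" using n by (auto simp: commute[of f])
    then show "\<exists>g\<in>\<Union>n. K n. d f g < e" using \<open>g \<in> K n\<close> by blast
  qed
qed

lemma small_powrE:
  fixes p k e :: real
  assumes "0 < p" "0 \<le> k" "0 < e"
  obtains s where "0 < s" "\<And>x. 0 \<le> x \<Longrightarrow> x < s \<Longrightarrow> k * x powr p \<le> e"
\<comment> \<open>Dividing by \<open>k + 1\<close> allows for \<open>k = 0\<close>.\<close>
proof (rule that[of "(e / (k + 1)) powr (1 / p)"])
  show "0 < (e / (k + 1)) powr (1 / p)" using assms by simp
  fix x assume "0 \<le> x" "x < (e / (k + 1)) powr (1 / p)"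
  then have "x powr p \<le> ((e / (k + 1)) powr (1 / p)) powr p" using assms by (intro powr_mono2) auto
  also have "\<dots> = e / (k + 1)" using assms by (simp add: powr_powr)
  finally have "k * x powr p \<le> k * (e / (k + 1))" using assms by (intro mult_left_mono) auto
  also have "\<dots> \<le> e" using assms by (simp add: field_simps)
  finally show "k * x powr p \<le> e" .
qed

lemma (in Metric_space) hoelder_INF_dense:
  fixes \<Phi> :: "'a \<Rightarrow> real"
  assumes D: "D \<subseteq> C" "\<And>f e. f \<in> C \<Longrightarrow> 0 < e \<Longrightarrow> \<exists>g\<in>D. d f g < e"
    and p: "0 < p" and k: "0 \<le> k" "\<And>f g. f \<in> C \<Longrightarrow> g \<in> C \<Longrightarrow> \<bar>\<Phi> f - \<Phi> g\<bar> \<le> k * d f g powr p"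
  shows "(INF f\<in>C. ereal (\<Phi> f)) = (INF f\<in>D. ereal (\<Phi> f))"
proof (rule antisym)
  show "(INF f\<in>C. ereal (\<Phi> f)) \<le> (INF f\<in>D. ereal (\<Phi> f))" by (rule INF_superset_mono[OF D(1)]) auto
  show "(INF f\<in>D. ereal (\<Phi> f)) \<le> (INF f\<in>C. ereal (\<Phi> f))"
  proof (rule INF_greatest, rule ereal_le_epsilon2)
    fix f and e :: real assume f: "f \<in> C" and e: "0 < e"
    obtain s where s: "0 < s" "\<And>x. 0 \<le> x \<Longrightarrow> x < s \<Longrightarrow> k * x powr p \<le> e"
      using small_powrE[OF p k(1) e] by blast
    obtain g where g: "g \<in> D" "d f g < s" using D(2)[OF f s(1)] by blast
    have "\<Phi> g \<le> \<Phi> f + e" using k(2)[OF f, of g] s(2)[OF nonneg g(2)] g D(1) by fastforce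
    then show "(INF f\<in>D. ereal (\<Phi> f)) \<le> ereal (\<Phi> f) + ereal e"
      using INF_lower[OF g(1), of "\<lambda>f. ereal (\<Phi> f)"] by (metis ereal_less_eq(3) order_trans plus_ereal.simps(1))
  qed
qed

lemma (in Metric_space) hoelder_compact_image:
  fixes \<Phi> :: "'a \<Rightarrow> real"
  assumes C: "compactin mtopology C"
    and p: "0 < p" and k: "0 \<le> k" "\<And>f g. f \<in> C \<Longrightarrow> g \<in> C \<Longrightarrow> \<bar>\<Phi> f - \<Phi> g\<bar> \<le> k * d f g powr p"
  shows "compact (\<Phi> ` C)"
  unfolding compact_eq_seq_compact_metric seq_compact_def
proof (intro allI impI)
  fix y :: "nat \<Rightarrow> real" assume "\<forall>n. y n \<in> \<Phi> ` C"
  then have "\<forall>n. \<exists>f. f \<in> C \<and> y n = \<Phi> f" by blast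
  from choice[OF this] obtain \<sigma> where \<sigma>: "\<And>n. \<sigma> n \<in> C" "\<And>n. y n = \<Phi> (\<sigma> n)" by blast
  have "range \<sigma> \<subseteq> C" using \<sigma>(1) by blast
  then obtain l r where l: "l \<in> C" "strict_mono r" "limitin mtopology (\<sigma> \<circ> r) l sequentially"
    using C unfolding compactin_sequentially by blast
  have "(\<lambda>n. y (r n)) \<longlonglongrightarrow> \<Phi> l"
  proof (rule LIMSEQ_I)
    fix e :: real assume e: "0 < e"
    obtain s where s: "0 < s" "\<And>x. 0 \<le> x \<Longrightarrow> x < s \<Longrightarrow> k * x powr p \<le> e / 2"
      using small_powrE[OF p k(1), of "e / 2"] e by auto
    have "\<exists>N. \<forall>n\<ge>N. (\<sigma> \<circ> r) n \<in> M \<and> d ((\<sigma> \<circ> r) n) l < s"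
      using l(3) s(1) unfolding limit_metric_sequentially by simp
    then obtain N where "\<And>n. n \<ge> N \<Longrightarrow> d (\<sigma> (r n)) l < s" by (auto simp: o_def)
    then have "\<bar>\<Phi> (\<sigma> (r n)) - \<Phi> l\<bar> < e" if "n \<ge> N" for n
      using k(2)[OF \<sigma>(1) l(1), of "r n"] s(2)[OF nonneg, of "\<sigma> (r n)" l] that e by fastforce
    then show "\<exists>N. \<forall>n\<ge>N. norm (y (r n) - \<Phi> l) < e" by (auto simp: \<sigma>(2))
  qed
  then show "\<exists>l\<in>\<Phi> ` C. \<exists>r. strict_mono r \<and> (y \<circ> r) \<longlonglongrightarrow> l" using l by (auto simp: o_def)
qed

text \<open>The infimum over a nonempty compact set is attained. Over the empty set it is
  \<infinity>, and \<open>v \<noteq> \<infinity>\<close> makes both sides false there.\<close>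

lemma (in Metric_space) hoelder_ex_le_iff_INF_le:
  fixes \<Phi> :: "'a \<Rightarrow> real"
  assumes C: "compactin mtopology C"
    and p: "0 < p" and k: "0 \<le> k" "\<And>f g. f \<in> C \<Longrightarrow> g \<in> C \<Longrightarrow> \<bar>\<Phi> f - \<Phi> g\<bar> \<le> k * d f g powr p"
    and v: "v \<noteq> \<infinity>"
  shows "(\<exists>f\<in>C. ereal (\<Phi> f) \<le> v) \<longleftrightarrow> (INF f\<in>C. ereal (\<Phi> f)) \<le> v"
proof
  assume "\<exists>f\<in>C. ereal (\<Phi> f) \<le> v"
  then show "(INF f\<in>C. ereal (\<Phi> f)) \<le> v" by (meson INF_lower2)
next
  assume le: "(INF f\<in>C. ereal (\<Phi> f)) \<le> v"
  have "C \<noteq> {}" using le v by (auto simp: top_ereal_def)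
  then obtain f where f: "f \<in> C" "\<And>g. g \<in> C \<Longrightarrow> \<Phi> f \<le> \<Phi> g"
    using compact_attains_inf[OF hoelder_compact_image[OF C p k]] by auto
  have "ereal (\<Phi> f) \<le> (INF f\<in>C. ereal (\<Phi> f))" by (rule INF_greatest) (use f(2) in auto)
  then show "\<exists>f\<in>C. ereal (\<Phi> f) \<le> v" using f(1) le by (meson order_trans)
qed

text \<open>The slack \<open>inverse (Suc k)\<close> replaces the infimum, which need not be
  attained; countably many values of it keep the condition within reach of a sigma-algebra.\<close>

lemma exs_le_iff:
  assumes "B \<noteq> {}" "0 \<le> h"
  shows "exs d A B \<le> ereal h \<longleftrightarrow> (\<forall>k. \<forall>f\<in>A. \<exists>g\<in>B. d f g < h + inverse (Suc k))"
proof -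
  have INF_iff: "(INF g\<in>B. ereal (d f g)) \<le> ereal h \<longleftrightarrow> (\<forall>k. \<exists>g\<in>B. d f g < h + inverse (Suc k))" for f
  proof
    assume le: "(INF g\<in>B. ereal (d f g)) \<le> ereal h"
    show "\<forall>k. \<exists>g\<in>B. d f g < h + inverse (Suc k)"
    proof
      fix k
      have "ereal h < ereal (h + inverse (Suc k))" by simp
      with le have "(INF g\<in>B. ereal (d f g)) < ereal (h + inverse (Suc k))" by (rule le_less_trans)
      then show "\<exists>g\<in>B. d f g < h + inverse (Suc k)" unfolding INF_less_iff by simp
    qed
  next
    assume *: "\<forall>k. \<exists>g\<in>B. d f g < h + inverse (Suc k)"
    show "(INF g\<in>B. ereal (d f g)) \<le> ereal h"
    proof (rule ereal_le_epsilon2)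
      fix e :: real assume "0 < e"
      then obtain k where k: "inverse (Suc k) < e" using reals_Archimedean by blast
      obtain g where g: "g \<in> B" "d f g < h + inverse (Suc k)" using * by blast
      have "ereal (d f g) \<le> ereal h + ereal e" using g(2) k by simp
      then show "(INF g\<in>B. ereal (d f g)) \<le> ereal h + ereal e" using g(1) by (meson INF_lower2)
    qed
  qed
  show ?thesis
  proof (cases "A = {}")
    case False
    then have "exs d A B \<le> ereal h \<longleftrightarrow> (\<forall>f\<in>A. (INF g\<in>B. ereal (d f g)) \<le> ereal h)"
      using assms(1) by (simp add: exs_def SUP_le_iff)
    then show ?thesis unfolding INF_iff by blast
  qed (use assms in \<open>simp add: exs_def\<close>)
qed

lemma (in Metric_space) closedin_mdist_ge:
  assumes "closedin mtopology F1" "B \<subseteq> M"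
  shows "closedin mtopology {f \<in> F1. \<forall>g\<in>B. c \<le> d f g}"
  unfolding metric_closedin_iff_sequentially_closed
proof (intro conjI allI impI)
  show "{f \<in> F1. \<forall>g\<in>B. c \<le> d f g} \<subseteq> M" using closedin_subset[OF assms(1)] by auto
  fix \<sigma> l assume a: "range \<sigma> \<subseteq> {f \<in> F1. \<forall>g\<in>B. c \<le> d f g} \<and> limitin mtopology \<sigma> l sequentially"
  have "range \<sigma> \<subseteq> F1" using a by blast
  then have l: "l \<in> F1" using a assms(1) unfolding metric_closedin_iff_sequentially_closed by blast
  have "c \<le> d l g" if g: "g \<in> B" for g
  proof (rule field_le_epsilon)
    fix e :: real assume "0 < e"
    then obtain n where n: "\<sigma> n \<in> M" "d (\<sigma> n) l < e" "l \<in> M" using a unfolding limit_metric_sequentially by blast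
    moreover have "c \<le> d (\<sigma> n) g" using a g by blast
    moreover have "d (\<sigma> n) g \<le> d (\<sigma> n) l + d l g" using n g assms(2) by (intro triangle) auto
    ultimately show "c \<le> d l g + e" by linarith
  qed
  then show "l \<in> {f \<in> F1. \<forall>g\<in>B. c \<le> d f g}" using l by blast
qed

text \<open>Near-minimizers outside the \<open>h\<close>-neighbourhood of \<open>B\<close> lie in one of countably many compact
  sets, on each of which the infimum is attained and may be taken over a countable dense subset.\<close>

lemma (in Metric_space) measurable_exs_eps_argmin:
  fixes \<Phi> :: "'x \<Rightarrow> 'a \<Rightarrow> real"
  assumes F1: "compactin mtopology F1" "F1 \<noteq> {}" and B: "B \<noteq> {}" "B \<subseteq> M" and h: "0 \<le> h"
    and meas: "\<And>f. f \<in> F1 \<Longrightarrow> (\<lambda>x. \<Phi> x f) \<in> borel_measurable N"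
    and p: "0 < p" and k: "\<And>x. x \<in> space N \<Longrightarrow> 0 \<le> k x"
      "\<And>x f g. x \<in> space N \<Longrightarrow> f \<in> F1 \<Longrightarrow> g \<in> F1 \<Longrightarrow> \<bar>\<Phi> x f - \<Phi> x g\<bar> \<le> k x * d f g powr p"
  shows "{x \<in> space N. exs d (eps_argmin \<epsilon> F1 (\<lambda>f. ereal (\<Phi> x f))) B \<le> ereal h} \<in> sets N"
proof -
  define Ck where "Ck j = {f \<in> F1. \<forall>g\<in>B. h + inverse (Suc j) \<le> d f g}" for j
  have F1_closed: "closedin mtopology F1"
    by (rule compactin_imp_closedin[OF Hausdorff_space_mtopology F1(1)])
  have Ck: "compactin mtopology (Ck j)" "Ck j \<subseteq> F1" for j
    unfolding Ck_def by (auto intro!: closed_compactin[OF F1(1)] closedin_mdist_ge F1_closed B)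
  obtain D0 where D0: "countable D0" "D0 \<subseteq> F1" "\<And>f e. f \<in> F1 \<Longrightarrow> 0 < e \<Longrightarrow> \<exists>g\<in>D0. d f g < e"
    using mtotally_bounded_imp_countable_dense[OF compactin_imp_mtotally_bounded[OF F1(1)]] by blast
  have "\<exists>D. countable D \<and> D \<subseteq> Ck j \<and> (\<forall>f e. f \<in> Ck j \<longrightarrow> 0 < e \<longrightarrow> (\<exists>g\<in>D. d f g < e))" for j
    using mtotally_bounded_imp_countable_dense[OF compactin_imp_mtotally_bounded[OF Ck(1)]] by metis
  then obtain D where D: "\<And>j. countable (D j)" "\<And>j. D j \<subseteq> Ck j"
      "\<And>j f e. f \<in> Ck j \<Longrightarrow> 0 < e \<Longrightarrow> \<exists>g\<in>D j. d f g < e"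
    by metis
  have "exs d (eps_argmin \<epsilon> F1 (\<lambda>f. ereal (\<Phi> x f))) B \<le> ereal h \<longleftrightarrow>
      (\<forall>j. \<not> (INF f\<in>D j. ereal (\<Phi> x f)) \<le> (INF f\<in>D0. ereal (\<Phi> x f)) + ereal \<epsilon>)"
    if x: "x \<in> space N" for x
  proof -
    define v where "v = (INF f\<in>F1. ereal (\<Phi> x f)) + ereal \<epsilon>"
    obtain f0 where f0: "f0 \<in> F1" using F1(2) by blast
    have "(INF f\<in>F1. ereal (\<Phi> x f)) \<le> ereal (\<Phi> x f0)" by (rule INF_lower[OF f0])
    \<comment> \<open>Needed because some \<open>Ck j\<close> may be empty, with infimum
      \<infinity>.\<close>
    then have v: "v \<noteq> \<infinity>" by (auto simp: v_def)
    have "exs d (eps_argmin \<epsilon> F1 (\<lambda>f. ereal (\<Phi> x f))) B \<le> ereal h \<longleftrightarrow>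
        (\<forall>j. \<not> (\<exists>f\<in>Ck j. ereal (\<Phi> x f) \<le> v))"
      unfolding exs_le_iff[OF B(1) h] eps_argmin_def v_def Ck_def by (auto simp: not_less) (meson linorder_not_le)+
    also have "\<dots> \<longleftrightarrow> (\<forall>j. \<not> (INF f\<in>Ck j. ereal (\<Phi> x f)) \<le> v)"
      using hoelder_ex_le_iff_INF_le[OF Ck(1) p k(1)[OF x] k(2)[OF x] v] Ck(2) by (simp add: subset_iff)
    also have "\<dots> \<longleftrightarrow> (\<forall>j. \<not> (INF f\<in>D j. ereal (\<Phi> x f)) \<le> v)"
      using hoelder_INF_dense[OF D(2,3) p k(1)[OF x] k(2)[OF x]] Ck(2) by (simp add: subset_iff)
    also have "v = (INF f\<in>D0. ereal (\<Phi> x f)) + ereal \<epsilon>"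
      unfolding v_def using hoelder_INF_dense[OF D0(2,3) p k(1)[OF x] k(2)[OF x]] by simp
    finally show ?thesis .
  qed
  then have eq: "{x \<in> space N. exs d (eps_argmin \<epsilon> F1 (\<lambda>f. ereal (\<Phi> x f))) B \<le> ereal h} =
      {x \<in> space N. \<forall>j. \<not> (INF f\<in>D j. ereal (\<Phi> x f)) \<le> (INF f\<in>D0. ereal (\<Phi> x f)) + ereal \<epsilon>}"
    by blast
  have [measurable]: "(\<lambda>x. INF f\<in>D0. ereal (\<Phi> x f)) \<in> borel_measurable N"
    using D0(2) by (intro borel_measurable_INF D0(1) borel_measurable_ereal meas) auto
  have [measurable]: "(\<lambda>x. INF f\<in>D j. ereal (\<Phi> x f)) \<in> borel_measurable N" for j
    using D(2) Ck(2) by (intro borel_measurable_INF D(1) borel_measurable_ereal meas) auto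
  show ?thesis unfolding eq by measurable
qed

section \<open>Stability of near-minimizers under perturbation\<close>

lemma exs_nonneg:
  assumes "\<And>f g. 0 \<le> d f g"
  shows "0 \<le> exs d A B"
proof (cases "A = {} \<or> B = {}")
  case False
  then obtain f where "f \<in> A" by blast
  then have "0 \<le> (SUP f\<in>A. INF g\<in>B. ereal (d f g))"
    by (rule SUP_upper2) (auto intro!: INF_greatest assms)
  then show ?thesis using False by (simp add: exs_def)
qed (auto simp: exs_def)

lemma ph_dist_nonneg: "(\<And>f g. 0 \<le> d f g) \<Longrightarrow> 0 \<le> ph_dist d A B"
  by (simp add: ph_dist_def exs_nonneg le_max_iff_disj)

text \<open>Let \<open>f\<close> be a near-minimizer, \<open>g\<close> in \<open>F0\<close> close to
  it, and compare \<open>g\<close> with any \<open>g0\<close> in \<open>F0\<close> through a close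
  \<open>f0\<close> in \<open>F1\<close>. The chain \<open>g\<close>, \<open>f\<close>,
  \<open>f0\<close>, \<open>g0\<close> costs two deviations \<open>a\<close>, the tolerance
  \<epsilon>, and two moves between \<open>F1\<close> and \<open>F0\<close>. Each move is shorter
  than \<open>h + r\<close>, hence than \<open>2 * r\<close>, which explains the condition on
  \<open>c\<close>.\<close>

lemma exs_eps_argmin_le:
  fixes \<Phi> \<phi> :: "'f \<Rightarrow> real"
  assumes F: "F1 \<subseteq> F" "F0 \<subseteq> F" "F1 \<noteq> {}" "F0 \<noteq> {}"
    and d: "\<And>f g. 0 \<le> d f g" and h: "0 < r" "ph_dist d F1 F0 \<le> ereal r"
    and dev: "\<And>f. f \<in> F \<Longrightarrow> \<bar>\<Phi> f - \<phi> f\<bar> \<le> a"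
    and p: "0 < p" and k: "0 \<le> k" "\<And>f g. f \<in> F \<Longrightarrow> g \<in> F \<Longrightarrow> \<bar>\<phi> f - \<phi> g\<bar> \<le> k * d f g powr p"
    and c: "2 * a + 2 * k * (2 * r) powr p \<le> c"
  shows "exs d (eps_argmin \<epsilon> F1 (\<lambda>f. ereal (\<Phi> f))) (eps_argmin (\<epsilon> + c) F0 (\<lambda>f. ereal (\<phi> f)))
    \<le> ph_dist d F1 F0"
proof -
  let ?A = "eps_argmin \<epsilon> F1 (\<lambda>f. ereal (\<Phi> f))" and ?B = "eps_argmin (\<epsilon> + c) F0 (\<lambda>f. ereal (\<phi> f))"
  obtain h where hr: "ph_dist d F1 F0 = ereal h" "0 \<le> h" "h \<le> r"
    using h(2) ph_dist_nonneg[of d F1 F0] d by (cases "ph_dist d F1 F0") auto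
  have near: "\<exists>g\<in>G2. d f g < h + e" if "exs d G1 G2 \<le> ereal h" "G1 \<noteq> {}" "G2 \<noteq> {}" "f \<in> G1" "0 < e"
    for G1 G2 f e
  proof -
    have "(INF g\<in>G2. ereal (d f g)) \<le> exs d G1 G2"
      using that by (auto simp: exs_def intro: SUP_upper)
    also have "\<dots> \<le> ereal h" by fact
    also have "\<dots> < ereal (h + e)" using that by simp
    finally show ?thesis unfolding INF_less_iff by simp
  qed
  have ex: "exs d F1 F0 \<le> ereal h" "exs d F0 F1 \<le> ereal h"
    unfolding hr(1)[symmetric] by (auto simp: ph_dist_def)
  have key: "g \<in> ?B" if f: "f \<in> ?A" and g: "g \<in> F0" "d f g < h + e" and e: "e \<le> r" for f g e
  proof -
    have fF: "f \<in> F1" using f by (auto simp: eps_argmin_def)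
    have w: "k * x powr p \<le> k * (2 * r) powr p" if "0 \<le> x" "x < h + r" for x
      using that hr k(1) p by (intro mult_left_mono powr_mono2) auto
    have "\<phi> g \<le> \<phi> g0 + (\<epsilon> + c)" if g0: "g0 \<in> F0" for g0
    proof -
      obtain f0 where f0: "f0 \<in> F1" "d g0 f0 < h + r" using near[OF ex(2) F(4,3) g0 h(1)] by blast
      have "ereal (\<Phi> f) \<le> (INF g\<in>F1. ereal (\<Phi> g)) + ereal \<epsilon>" using f by (simp add: eps_argmin_def)
      also have "\<dots> \<le> ereal (\<Phi> f0) + ereal \<epsilon>" by (intro add_right_mono INF_lower f0)
      finally have "\<Phi> f \<le> \<Phi> f0 + \<epsilon>" by simp
      moreover have "\<bar>\<Phi> f - \<phi> f\<bar> \<le> a" "\<bar>\<Phi> f0 - \<phi> f0\<bar> \<le> a" using fF f0 F by (auto intro: dev)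
      moreover have "\<bar>\<phi> f - \<phi> g\<bar> \<le> k * (2 * r) powr p"
        using k(2)[of f g] w[of "d f g"] fF g F d[of f g] e by force
      moreover have "\<bar>\<phi> g0 - \<phi> f0\<bar> \<le> k * (2 * r) powr p"
        using k(2)[of g0 f0] w[of "d g0 f0"] f0 g0 F d[of g0 f0] by force
      ultimately show ?thesis using c by linarith
    qed
    then have "ereal (\<phi> g - (\<epsilon> + c)) \<le> (INF g\<in>F0. ereal (\<phi> g))"
      by (intro INF_greatest) (simp add: diff_le_eq)
    then have "ereal (\<phi> g - (\<epsilon> + c)) + ereal (\<epsilon> + c) \<le> (INF g\<in>F0. ereal (\<phi> g)) + ereal (\<epsilon> + c)"
      by (rule add_right_mono)
    then show ?thesis using g(1) by (simp add: eps_argmin_def)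
  qed
  show ?thesis
  proof (cases "?A = {}")
    case True
    then show ?thesis using hr by (simp add: exs_def)
  next
    case False
    have nearB: "\<exists>g\<in>?B. d f g < h + e" if f: "f \<in> ?A" and e: "0 < e" for f e
    proof -
      have "f \<in> F1" using f by (auto simp: eps_argmin_def)
      \<comment> \<open>Capping \<open>e\<close> at \<open>r\<close> keeps \<open>g\<close> within
        the reach of \<open>key\<close>.\<close>
      then obtain g where g: "g \<in> F0" "d f g < h + min e r" using near[OF ex(1) F(3,4), of f "min e r"] e h(1) by auto
      then show ?thesis using key[OF f g] by (intro bexI[of _ g]) auto
    qed
    have "?B \<noteq> {}" using False nearB[of _ 1] by fastforce
    then show ?thesis
      unfolding hr(1) using exs_le_iff[of ?B h d ?A] hr(2) nearB by simp
  qed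
qed

section \<open>Uniform deviation of sample means\<close>

abbreviation sample :: "'x measure \<Rightarrow> nat \<Rightarrow> (nat \<Rightarrow> 'x) measure" where
  "sample P \<nu> \<equiv> Pi\<^sub>M {1..\<nu>} (\<lambda>_. P)"

text \<open>The sign \<open>s\<close> selects the upper or the lower tail. The exponent
  \<open>\<tau> = s * t / lam\<^sup>2\<close> minimizes Chernoff's bound, and
  \<open>t \<le> lam\<close> keeps it in the range where the moment generating function is
  controlled. Independence enters as the factorization of the integral of \<open>u\<close>, a
  product over the coordinates.\<close>

lemma sub_exponential_tail:
  fixes Y :: "'x \<Rightarrow> real"
  assumes P: "prob_space P" and Y[measurable]: "Y \<in> borel_measurable P" and lam: "0 < lam"
    and mgf: "\<And>\<tau>. \<bar>\<tau>\<bar> * lam \<le> 1 \<Longrightarrow>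
      (\<integral>\<^sup>+\<xi>. ennreal (exp (\<tau> * (Y \<xi> - m))) \<partial>P) \<le> ennreal (exp (\<tau>\<^sup>2 * lam\<^sup>2 / 2))"
    and t: "0 < t" "t \<le> lam" and s: "\<bar>s\<bar> = 1"
  shows "measure (sample P \<nu>) {x \<in> space (sample P \<nu>). t * real \<nu> \<le> s * (\<Sum>j=1..\<nu>. Y (x j) - m)}
    \<le> exp (- (real \<nu> * (t\<^sup>2 / (2 * lam\<^sup>2))))"
proof -
  interpret PP: product_prob_space "\<lambda>_::nat. P" by (rule product_prob_spaceI[OF P])
  interpret Pi: prob_space "sample P \<nu>" by (intro prob_space_PiM P)
  define \<tau> c where "\<tau> = s * t / lam\<^sup>2" and "c = exp (- (real \<nu> * (t\<^sup>2 / lam\<^sup>2)))"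
  define u where "u x = (\<Prod>j=1..\<nu>. ennreal (exp (\<tau> * (Y (x j) - m))))" for x :: "nat \<Rightarrow> 'x"
  have s2: "s\<^sup>2 = 1" using s by (metis one_power2 power2_abs)
  have u: "u x = ennreal (exp (\<tau> * (\<Sum>j=1..\<nu>. Y (x j) - m)))" for x
    by (simp add: u_def prod_ennreal exp_sum sum_distrib_left)
  have [measurable]: "u \<in> borel_measurable (sample P \<nu>)" unfolding u_def by measurable
  have iff: "t * real \<nu> \<le> s * (\<Sum>j=1..\<nu>. Y (x j) - m) \<longleftrightarrow> 1 \<le> ennreal c * u x" for x
  proof -
    define T where "T = (\<Sum>j=1..\<nu>. Y (x j) - m)"
    have "1 \<le> ennreal c * u x \<longleftrightarrow> 1 \<le> exp (\<tau> * T - real \<nu> * (t\<^sup>2 / lam\<^sup>2))"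
      unfolding u T_def[symmetric] c_def
      by (simp add: ennreal_mult[symmetric] exp_diff exp_minus field_simps flip: ennreal_1)
    also have "\<dots> \<longleftrightarrow> 0 \<le> \<tau> * T - real \<nu> * (t\<^sup>2 / lam\<^sup>2)" by simp
    also have "\<tau> * T - real \<nu> * (t\<^sup>2 / lam\<^sup>2) = (t / lam\<^sup>2) * (s * T - t * real \<nu>)"
      by (simp add: \<tau>_def power2_eq_square algebra_simps)
    also have "0 \<le> (t / lam\<^sup>2) * (s * T - t * real \<nu>) \<longleftrightarrow> 0 \<le> s * T - t * real \<nu>"
    proof -
      have "0 < t / lam\<^sup>2" using t lam by simp
      then show ?thesis unfolding zero_le_mult_iff by linarith
    qed
    finally show ?thesis by (simp add: T_def)
  qed
  have "\<bar>\<tau>\<bar> * lam = t / lam"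
    using s t lam by (simp add: \<tau>_def abs_mult power2_eq_square)
  then have \<tau>: "\<bar>\<tau>\<bar> * lam \<le> 1" using t lam by simp
  have "(\<integral>\<^sup>+x. u x \<partial>sample P \<nu>) = (\<Prod>j=1..\<nu>. \<integral>\<^sup>+\<xi>. ennreal (exp (\<tau> * (Y \<xi> - m))) \<partial>P)"
    unfolding u_def by (subst PP.product_nn_integral_prod) auto
  also have "\<dots> \<le> (\<Prod>j=1..\<nu>. ennreal (exp (\<tau>\<^sup>2 * lam\<^sup>2 / 2)))"
    by (intro prod_mono_ennreal mgf[OF \<tau>])
  also have "\<dots> = ennreal (exp (real \<nu> * (\<tau>\<^sup>2 * lam\<^sup>2 / 2)))"
    by (simp add: ennreal_power exp_of_nat_mult[symmetric])
  finally have int: "(\<integral>\<^sup>+x. u x \<partial>sample P \<nu>) \<le> ennreal (exp (real \<nu> * (\<tau>\<^sup>2 * lam\<^sup>2 / 2)))" .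
  have "emeasure (sample P \<nu>) {x \<in> space (sample P \<nu>). 1 \<le> ennreal c * u x}
      \<le> ennreal c * (\<integral>\<^sup>+x. u x * indicator (space (sample P \<nu>)) x \<partial>sample P \<nu>)"
    by (rule nn_integral_Markov_inequality) measurable
  also have "(\<integral>\<^sup>+x. u x * indicator (space (sample P \<nu>)) x \<partial>sample P \<nu>) = (\<integral>\<^sup>+x. u x \<partial>sample P \<nu>)"
    by (intro nn_integral_cong) simp
  also have "ennreal c * \<dots> \<le> ennreal c * ennreal (exp (real \<nu> * (\<tau>\<^sup>2 * lam\<^sup>2 / 2)))"
    by (intro mult_left_mono int) simp
  also have "\<dots> = ennreal (exp (- (real \<nu> * (t\<^sup>2 / lam\<^sup>2)) + real \<nu> * (\<tau>\<^sup>2 * lam\<^sup>2 / 2)))"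
    by (simp only: c_def exp_add ennreal_mult[OF exp_ge_zero exp_ge_zero])
  also have "\<tau>\<^sup>2 * lam\<^sup>2 = t\<^sup>2 / lam\<^sup>2"
  proof -
    have "\<tau> * lam = s * t / lam" using lam by (simp add: \<tau>_def power2_eq_square)
    then have "(\<tau> * lam)\<^sup>2 = (s * t / lam)\<^sup>2" by simp
    then show ?thesis by (simp add: power_mult_distrib power_divide s2)
  qed
  also have "- (real \<nu> * (t\<^sup>2 / lam\<^sup>2)) + real \<nu> * (t\<^sup>2 / lam\<^sup>2 / 2) = - (real \<nu> * (t\<^sup>2 / (2 * lam\<^sup>2)))"
    by (simp add: field_simps)
  finally show ?thesis unfolding iff Pi.emeasure_eq_measure by (simp only: ennreal_le_iff[OF exp_ge_zero])
qed

text \<open>Only integrability of \<kappa> is available, so no exponential bound can be asked for.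
  The sample mean has the expectation of \<kappa>, which makes the bound independent of
  \<nu>.\<close>

lemma sample_mean_markov:
  fixes \<kappa> :: "'x \<Rightarrow> real"
  assumes P: "prob_space P" and \<kappa>: "integrable P \<kappa>" "\<And>\<xi>. \<xi> \<in> space P \<Longrightarrow> 0 \<le> \<kappa> \<xi>"
    and K: "0 < K" and \<nu>: "1 \<le> \<nu>"
  shows "measure (sample P \<nu>) {x \<in> space (sample P \<nu>). K \<le> (\<Sum>j=1..\<nu>. \<kappa> (x j)) / real \<nu>}
    \<le> (\<integral>\<xi>. \<kappa> \<xi> \<partial>P) / K"
proof -
  have distr: "distr (sample P \<nu>) P (\<lambda>x. x j) = P" if "j \<in> {1..\<nu>}" for j
    using distr_PiM_component[of "{1..\<nu>}" "\<lambda>_. P" j] P that by simp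
  have comp: "(\<lambda>x. x j) \<in> measurable (sample P \<nu>) P" if "j \<in> {1..\<nu>}" for j
    using that by (rule measurable_component_singleton)
  have int: "integrable (sample P \<nu>) (\<lambda>x. \<kappa> (x j))" if j: "j \<in> {1..\<nu>}" for j
    using \<kappa>(1) integrable_distr_eq[OF comp[OF j], of \<kappa>] distr[OF j] by simp
  have eq: "(\<integral>x. \<kappa> (x j) \<partial>sample P \<nu>) = (\<integral>\<xi>. \<kappa> \<xi> \<partial>P)" if j: "j \<in> {1..\<nu>}" for j
    using \<kappa>(1) integral_distr[OF comp[OF j], of \<kappa>] distr[OF j] by simp
  have "measure (sample P \<nu>) {x \<in> space (sample P \<nu>). K \<le> (\<Sum>j=1..\<nu>. \<kappa> (x j)) / real \<nu>}
      \<le> (\<integral>x. (\<Sum>j=1..\<nu>. \<kappa> (x j)) / real \<nu> \<partial>sample P \<nu>) / K"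
  proof (rule integral_Markov_inequality_measure)
    show "integrable (sample P \<nu>) (\<lambda>x. (\<Sum>j=1..\<nu>. \<kappa> (x j)) / real \<nu>)"
      by (intro integrable_divide Bochner_Integration.integrable_sum int) simp
    show "AE x in sample P \<nu>. 0 \<le> (\<Sum>j=1..\<nu>. \<kappa> (x j)) / real \<nu>"
      by (intro AE_I2 divide_nonneg_nonneg sum_nonneg \<kappa>(2)) (auto simp: space_PiM)
  qed (use K in auto)
  also have "(\<integral>x. (\<Sum>j=1..\<nu>. \<kappa> (x j)) / real \<nu> \<partial>sample P \<nu>) =
      (\<Sum>j=1..\<nu>. \<integral>x. \<kappa> (x j) \<partial>sample P \<nu>) / real \<nu>"
    by (subst Bochner_Integration.integral_sum[OF int, symmetric]) auto
  also have "\<dots> = (\<integral>\<xi>. \<kappa> \<xi> \<partial>P)" using \<nu> by (simp add: eq del: One_nat_def)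
  finally show ?thesis .
qed

text \<open>Passing from \<open>f\<close> to a centre \<open>g\<close> costs at most
  \<open>K * w powr p\<close> in the sample mean and \<open>k * w powr p\<close> in the expectation;
  at \<open>g\<close> itself the deviation is at most \<open>t\<close>. The exceptional set consists
  of two tails for each centre and of the samples on which the mean of \<kappa> reaches
  \<open>K\<close>.\<close>

lemma uniform_deviation:
  fixes Y :: "'x \<Rightarrow> 'f \<Rightarrow> real"
  assumes P: "prob_space P" and G: "finite G" "G \<subseteq> F" "\<And>f. f \<in> F \<Longrightarrow> \<exists>g\<in>G. d f g \<le> w"
    and d: "\<And>f g. 0 \<le> d f g" and p: "0 \<le> p"
    and Y: "\<And>f. f \<in> F \<Longrightarrow> (\<lambda>\<xi>. Y \<xi> f) \<in> borel_measurable P" and lam: "0 < lam"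
    and mgf: "\<And>f \<tau>. f \<in> F \<Longrightarrow> \<bar>\<tau>\<bar> * lam \<le> 1 \<Longrightarrow>
      (\<integral>\<^sup>+\<xi>. ennreal (exp (\<tau> * (Y \<xi> f - m f))) \<partial>P) \<le> ennreal (exp (\<tau>\<^sup>2 * lam\<^sup>2 / 2))"
    and \<kappa>: "integrable P \<kappa>" "\<And>\<xi>. \<xi> \<in> space P \<Longrightarrow> 0 \<le> \<kappa> \<xi>"
    and hoelder: "\<And>\<xi> f g. \<xi> \<in> space P \<Longrightarrow> f \<in> F \<Longrightarrow> g \<in> F \<Longrightarrow> \<bar>Y \<xi> f - Y \<xi> g\<bar> \<le> \<kappa> \<xi> * d f g powr p"
      "\<And>f g. f \<in> F \<Longrightarrow> g \<in> F \<Longrightarrow> \<bar>m f - m g\<bar> \<le> k * d f g powr p"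
    and k: "k = (\<integral>\<xi>. \<kappa> \<xi> \<partial>P)"
    and t: "0 < t" "t \<le> lam" and K: "0 < K" and \<nu>: "1 \<le> \<nu>"
  obtains E where "E \<in> sets (sample P \<nu>)"
    "measure (sample P \<nu>) E \<ge> 1 - (real (card G) * (2 * exp (- (real \<nu> * (t\<^sup>2 / (2 * lam\<^sup>2))))) + k / K)"
    "\<forall>x\<in>E. \<forall>f\<in>F. \<bar>(\<Sum>j=1..\<nu>. Y (x j) f) / real \<nu> - m f\<bar> \<le> t + (K + k) * w powr p"
proof -
  interpret Pi: prob_space "sample P \<nu>" by (intro prob_space_PiM P)
  let ?S = "space (sample P \<nu>)"
  have k0: "0 \<le> k" unfolding k by (intro integral_nonneg_AE AE_I2 \<kappa>(2))
  define e where "e = exp (- (real \<nu> * (t\<^sup>2 / (2 * lam\<^sup>2))))"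
  define Bd where "Bd = (\<lambda>(g, s::real). {x \<in> ?S. t * real \<nu> \<le> s * (\<Sum>j=1..\<nu>. Y (x j) g - m g)})"
  define Bk where "Bk = {x \<in> ?S. K \<le> (\<Sum>j=1..\<nu>. \<kappa> (x j)) / real \<nu>}"
  have [measurable]: "\<kappa> \<in> borel_measurable P" using \<kappa>(1) by auto
  have Bd_sets: "Bd gs \<in> sets (sample P \<nu>)" if "gs \<in> G \<times> {1, - 1}" for gs
  proof -
    have [measurable]: "(\<lambda>\<xi>. Y \<xi> (fst gs)) \<in> borel_measurable P" using Y G(2) that by auto
    have "Bd gs = {x \<in> ?S. t * real \<nu> \<le> snd gs * (\<Sum>j=1..\<nu>. Y (x j) (fst gs) - m (fst gs))}"
      by (simp add: Bd_def case_prod_beta)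
    also have "\<dots> \<in> sets (sample P \<nu>)" by measurable
    finally show ?thesis .
  qed
  have Bk_sets: "Bk \<in> sets (sample P \<nu>)" unfolding Bk_def by measurable
  define bad where "bad = (\<Union>gs\<in>G \<times> {1, - 1}. Bd gs) \<union> Bk"
  have U_sets: "(\<Union>gs\<in>G \<times> {1, - 1}. Bd gs) \<in> sets (sample P \<nu>)"
    using G(1) Bd_sets by (intro sets.finite_UN) auto
  have bad_sets: "bad \<in> sets (sample P \<nu>)" unfolding bad_def using U_sets Bk_sets by blast
  have "measure (sample P \<nu>) bad \<le> measure (sample P \<nu>) (\<Union>gs\<in>G \<times> {1, - 1}. Bd gs) + measure (sample P \<nu>) Bk"
    unfolding bad_def by (rule measure_Un_le[OF U_sets Bk_sets])
  also have "measure (sample P \<nu>) (\<Union>gs\<in>G \<times> {1, - 1}. Bd gs) \<le> (\<Sum>gs\<in>G \<times> {1, - 1}. measure (sample P \<nu>) (Bd gs))"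
    using G(1) Bd_sets by (intro Pi.finite_measure_subadditive_finite) auto
  also have "\<dots> \<le> (\<Sum>gs\<in>G \<times> {1, - 1 :: real}. e)"
  proof (rule sum_mono)
    fix gs assume "gs \<in> G \<times> {1, - 1 :: real}"
    then obtain g s where gs: "gs = (g, s)" "g \<in> F" "\<bar>s\<bar> = 1" using G(2) by auto
    show "measure (sample P \<nu>) (Bd gs) \<le> e"
      unfolding gs(1) Bd_def case_prod_conv e_def
      by (rule sub_exponential_tail[OF P Y[OF gs(2)] lam mgf[OF gs(2)] t gs(3)])
  qed
  also have "\<dots> = real (card G) * (2 * e)" using G(1) by (simp add: card_cartesian_product)
  also have "measure (sample P \<nu>) Bk \<le> k / K"
    unfolding Bk_def k by (rule sample_mean_markov[OF P \<kappa> K \<nu>])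
  finally have bad: "measure (sample P \<nu>) bad \<le> real (card G) * (2 * e) + k / K" by simp
  show thesis
  proof (rule that[of "?S - bad"])
    show "?S - bad \<in> sets (sample P \<nu>)" using bad_sets by blast
    show "measure (sample P \<nu>) (?S - bad) \<ge> 1 - (real (card G) * (2 * exp (- (real \<nu> * (t\<^sup>2 / (2 * lam\<^sup>2))))) + k / K)"
      using Pi.prob_compl[OF bad_sets] bad by (simp add: e_def)
    show "\<forall>x\<in>?S - bad. \<forall>f\<in>F. \<bar>(\<Sum>j=1..\<nu>. Y (x j) f) / real \<nu> - m f\<bar> \<le> t + (K + k) * w powr p"
    proof (intro ballI)
      fix x f assume x: "x \<in> ?S - bad" and f: "f \<in> F"
      have xP: "x j \<in> space P" if "j \<in> {1..\<nu>}" for j using x that by (auto simp: space_PiM)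
      obtain g where g: "g \<in> G" "d f g \<le> w" using G(3)[OF f] by blast
      have gF: "g \<in> F" using g G(2) by blast
      have w: "d f g powr p \<le> w powr p" using g(2) d p by (intro powr_mono2) auto
      have \<nu>0: "0 < real \<nu>" using \<nu> by simp
      have not_bd: "\<not> t * real \<nu> \<le> s * (\<Sum>j=1..\<nu>. Y (x j) g - m g)" if "s = 1 \<or> s = - 1" for s :: real
      proof -
        have "x \<notin> Bd (g, s)" using x g(1) that by (auto simp: bad_def)
        then show ?thesis using x by (auto simp: Bd_def)
      qed
      have mg: "\<bar>(\<Sum>j=1..\<nu>. Y (x j) g) / real \<nu> - m g\<bar> \<le> t"
      proof -
        have "(\<Sum>j=1..\<nu>. Y (x j) g) / real \<nu> - m g = (\<Sum>j=1..\<nu>. Y (x j) g - m g) / real \<nu>"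
          using \<nu>0 by (simp add: sum_subtractf field_simps)
        moreover have "\<bar>\<Sum>j=1..\<nu>. Y (x j) g - m g\<bar> \<le> t * real \<nu>"
          using not_bd[of 1] not_bd[of "- 1"] by linarith
        ultimately show ?thesis using \<nu>0 by (simp add: abs_divide field_simps)
      qed
      have "(\<Sum>j=1..\<nu>. \<kappa> (x j)) / real \<nu> \<le> K" using x by (auto simp: bad_def Bk_def)
      then have sum\<kappa>: "(\<Sum>j=1..\<nu>. \<kappa> (x j)) \<le> K * real \<nu>" using \<nu>0 by (simp add: field_simps)
      have "\<bar>(\<Sum>j=1..\<nu>. Y (x j) f) - (\<Sum>j=1..\<nu>. Y (x j) g)\<bar> \<le> (\<Sum>j=1..\<nu>. \<bar>Y (x j) f - Y (x j) g\<bar>)"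
        unfolding sum_subtractf[symmetric] by (rule sum_abs)
      also have "\<dots> \<le> (\<Sum>j=1..\<nu>. \<kappa> (x j) * w powr p)"
      proof (rule sum_mono)
        fix j assume j: "j \<in> {1..\<nu>}"
        have "\<bar>Y (x j) f - Y (x j) g\<bar> \<le> \<kappa> (x j) * d f g powr p" by (rule hoelder(1)[OF xP[OF j] f gF])
        also have "\<dots> \<le> \<kappa> (x j) * w powr p" by (intro mult_left_mono w \<kappa>(2) xP[OF j])
        finally show "\<bar>Y (x j) f - Y (x j) g\<bar> \<le> \<kappa> (x j) * w powr p" .
      qed
      also have "\<dots> = (\<Sum>j=1..\<nu>. \<kappa> (x j)) * w powr p" by (simp add: sum_distrib_right)
      also have "\<dots> \<le> K * real \<nu> * w powr p" by (intro mult_right_mono sum\<kappa>) simp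
      finally have "\<bar>(\<Sum>j=1..\<nu>. Y (x j) f) - (\<Sum>j=1..\<nu>. Y (x j) g)\<bar> / real \<nu> \<le> K * w powr p"
        using \<nu>0 by (simp add: field_simps)
      then have fg: "\<bar>(\<Sum>j=1..\<nu>. Y (x j) f) / real \<nu> - (\<Sum>j=1..\<nu>. Y (x j) g) / real \<nu>\<bar> \<le> K * w powr p"
        using \<nu>0 by (simp add: diff_divide_distrib[symmetric] abs_divide)
      have "\<bar>m f - m g\<bar> \<le> k * w powr p"
        using hoelder(2)[OF f gF] mult_left_mono[OF w k0] by linarith
      with fg mg show "\<bar>(\<Sum>j=1..\<nu>. Y (x j) f) / real \<nu> - m f\<bar> \<le> t + (K + k) * w powr p"
        unfolding distrib_right by linarith
    qed
  qed
qed

text \<open>With \<open>\<infinity> - \<infinity> = \<infinity>\<close>, a finite difference of the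
  two parts forces both to be finite, and the Lebesgue integral applies.\<close>

lemma expect_eq_integral:
  fixes Y :: "'x \<Rightarrow> real"
  assumes Y: "Y \<in> borel_measurable P" and eq: "\<And>\<xi>. \<xi> \<in> space P \<Longrightarrow> Z \<xi> = ereal (Y \<xi>)"
    and fin: "\<bar>expect P Z\<bar> \<noteq> \<infinity>"
  shows "integrable P Y" "expect P Z = ereal (\<integral>\<xi>. Y \<xi> \<partial>P)"
proof -
  have 1: "(\<integral>\<^sup>+\<xi>. e2ennreal (Z \<xi>) \<partial>P) = (\<integral>\<^sup>+\<xi>. ennreal (Y \<xi>) \<partial>P)"
    by (intro nn_integral_cong) (simp add: eq e2ennreal_ereal)
  have 2: "(\<integral>\<^sup>+\<xi>. e2ennreal (- Z \<xi>) \<partial>P) = (\<integral>\<^sup>+\<xi>. ennreal (- Y \<xi>) \<partial>P)"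
    by (intro nn_integral_cong) (simp add: eq e2ennreal_ereal)
  define a b where "a = (\<integral>\<^sup>+\<xi>. ennreal (Y \<xi>) \<partial>P)" and "b = (\<integral>\<^sup>+\<xi>. ennreal (- Y \<xi>) \<partial>P)"
  have ex: "expect P Z = enn2ereal a - enn2ereal b" by (simp add: expect_def 1 2 a_def b_def)
  have ab: "a \<noteq> \<infinity>" "b \<noteq> \<infinity>"
    using fin unfolding ex by (cases a; cases b; simp)+
  then show int: "integrable P Y" unfolding real_integrable_def using Y by (simp add: a_def b_def)
  show "expect P Z = ereal (\<integral>\<xi>. Y \<xi> \<partial>P)"
    unfolding ex real_lebesgue_integral_def[OF int] a_def[symmetric] b_def[symmetric]
    using ab by (cases a; cases b) auto
qed

section \<open>The rate and the theorem\<close>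

lemma rate_pos: "2 \<le> \<nu> \<Longrightarrow> 0 < rate n p \<nu>"
  by (simp add: rate_def)

lemma rate_powr:
  assumes "2 \<le> \<nu>" "0 < p"
  shows "rate n p \<nu> powr (2 + real n / p) = ln (real \<nu>) powr (1 + real n) / real \<nu>"
proof -
  have s: "2 + real n / p \<noteq> 0" using assms by (smt (verit) divide_nonneg_pos of_nat_0_le_iff)
  have "rate n p \<nu> powr (2 + real n / p) = real \<nu> powr (- 1) * ln (real \<nu>) powr (1 + real n)"
    unfolding rate_def using assms s by (simp add: powr_mult powr_powr)
  then show ?thesis using assms by (simp add: powr_minus_divide)
qed

lemma rate_tendsto_0:
  assumes "0 < p"
  shows "rate n p \<longlonglongrightarrow> 0"
proof -
  define s where "s = 2 + real n / p"
  have s: "0 < s" using assms by (simp add: s_def add_pos_nonneg)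
  have lim: "(\<lambda>\<nu>. ln (real \<nu>) powr (1 + real n) / real \<nu>) \<longlonglongrightarrow> 0" by real_asymp
  have "(\<lambda>\<nu>. (ln (real \<nu>) powr (1 + real n) / real \<nu>) powr (1 / s)) \<longlonglongrightarrow> 0"
    by (rule tendsto_zero_powrI[OF lim tendsto_const]) (use s in auto)
  then show ?thesis
  proof (rule Lim_transform_eventually)
    show "\<forall>\<^sub>F \<nu> in sequentially. (ln (real \<nu>) powr (1 + real n) / real \<nu>) powr (1 / s) = rate n p \<nu>"
      using eventually_ge_at_top[of 2]
    proof eventually_elim
      case (elim \<nu>)
      have "(ln (real \<nu>) powr (1 + real n) / real \<nu>) powr (1 / s) = (rate n p \<nu> powr s) powr (1 / s)"
        unfolding s_def rate_powr[OF elim assms] ..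
      also have "\<dots> = rate n p \<nu>" using s rate_pos[OF elim, of n p] by (simp add: powr_powr)
      finally show ?case .
    qed
  qed
qed

text \<open>This is the equation that the rate solves: the left side is a tail exponent at deviation
  of order \<open>rate\<close>, the right side a covering exponent at radius
  \<open>rate powr (1 / p)\<close>, with \<open>ln \<nu>\<close> in place of the logarithm of the
  inverse radius.\<close>

lemma rate_square:
  assumes "2 \<le> \<nu>" "0 < p"
  shows "real \<nu> * (rate n p \<nu>)\<^sup>2 = ln (real \<nu>) ^ (n + 1) / rate n p \<nu> powr (real n / p)"
proof -
  define r where "r = rate n p \<nu>"
  have r: "0 < r" using rate_pos[OF assms(1)] by (simp add: r_def)
  have "r\<^sup>2 = r powr (2 + real n / p) / r powr (real n / p)"
    using r by (simp add: powr_diff[symmetric] powr_numeral)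
  also have "r powr (2 + real n / p) = ln (real \<nu>) powr (1 + real n) / real \<nu>"
    unfolding r_def by (rule rate_powr[OF assms])
  also have "ln (real \<nu>) powr (1 + real n) = ln (real \<nu>) ^ (n + 1)"
    using assms powr_realpow[of "ln (real \<nu>)" "n + 1"] by (simp add: add.commute)
  finally show ?thesis using assms by (simp add: r_def)
qed

lemma ln_ge_1:
  assumes "3 \<le> \<nu>"
  shows "1 \<le> ln (real \<nu>)"
  using assms exp_le by (subst ln_ge_iff) auto

text \<open>Dropping the logarithm, which is at least 1, leaves \<nu> to the power
  \<open>1 - 2 / s\<close>; \<open>n \<ge> 1\<close> makes \<open>s\<close> exceed 2. The divergence
  pushes the tail below any prescribed probability.\<close>

lemma rate_square_at_top:
  assumes "0 < p" "1 \<le> n"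
  shows "filterlim (\<lambda>\<nu>. real \<nu> * (rate n p \<nu>)\<^sup>2) at_top sequentially"
proof (rule filterlim_at_top_mono)
  define s where "s = 2 + real n / p"
  have s: "2 < s" using assms by (simp add: s_def)
  define \<theta> where "\<theta> = 1 - 2 / s"
  have "0 < \<theta>" using s by (simp add: \<theta>_def)
  then show "filterlim (\<lambda>\<nu>. real \<nu> powr \<theta>) at_top sequentially" by real_asymp
  show "\<forall>\<^sub>F \<nu> in sequentially. real \<nu> powr \<theta> \<le> real \<nu> * (rate n p \<nu>)\<^sup>2"
    using eventually_ge_at_top[of 3]
  proof eventually_elim
    case (elim \<nu>)
    have "1 \<le> ln (real \<nu>) powr ((1 + real n) / s)"
      using ln_ge_1[OF elim] s by (intro ge_one_powr_ge_zero) auto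
    then have "real \<nu> powr (- 1 / s) * 1 \<le> rate n p \<nu>"
      unfolding rate_def s_def[symmetric] by (intro mult_left_mono) auto
    then have "(real \<nu> powr (- 1 / s))\<^sup>2 \<le> (rate n p \<nu>)\<^sup>2" by (intro power_mono) auto
    then have "real \<nu> * (real \<nu> powr (- 1 / s))\<^sup>2 \<le> real \<nu> * (rate n p \<nu>)\<^sup>2" by (intro mult_left_mono) auto
    moreover have "real \<nu> * (real \<nu> powr (- 1 / s))\<^sup>2 = real \<nu> powr \<theta>"
    proof -
      have "(real \<nu> powr (- 1 / s))\<^sup>2 = real \<nu> powr (- 2 / s)"
        by (simp add: power2_eq_square powr_add[symmetric])
      moreover have "real \<nu> powr 1 * real \<nu> powr (- 2 / s) = real \<nu> powr \<theta>"
        unfolding powr_add[symmetric] by (simp add: \<theta>_def)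
      ultimately show ?thesis using elim by simp
    qed
    ultimately show ?case by simp
  qed
qed

text \<open>The logarithmic factor only increases the rate, and the exponent of \<nu> in it is at
  least -1. This replaces the logarithm in the covering number by \<open>ln \<nu>\<close>.\<close>

lemma ln_inverse_rate_le:
  assumes "3 \<le> \<nu>" "0 < p"
  shows "ln (1 / rate n p \<nu>) \<le> ln (real \<nu>)"
proof -
  define s where "s = 2 + real n / p"
  have s: "1 \<le> s" using assms divide_nonneg_pos[of "real n" p] by (simp add: s_def)
  have L: "1 \<le> ln (real \<nu>)" by (rule ln_ge_1[OF assms(1)])
  have "ln (rate n p \<nu>) = - 1 / s * ln (real \<nu>) + (1 + real n) / s * ln (ln (real \<nu>))"
    unfolding rate_def s_def[symmetric] using assms L by (subst ln_mult) (auto simp: ln_powr)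
  moreover have "0 \<le> (1 + real n) / s * ln (ln (real \<nu>))" using s L by simp
  moreover have "1 / s * ln (real \<nu>) \<le> 1 * ln (real \<nu>)" using s L by (intro mult_right_mono) auto
  moreover have "ln (1 / rate n p \<nu>) = - ln (rate n p \<nu>)" using rate_pos[of \<nu> n p] assms by (simp add: ln_div)
  ultimately show ?thesis by simp
qed

lemma eps_argmin_cong: "(\<And>f. f \<in> G \<Longrightarrow> \<phi> f = \<phi>' f) \<Longrightarrow> eps_argmin \<epsilon> G \<phi> = eps_argmin \<epsilon> G \<phi>'"
  by (auto simp: eps_argmin_def cong: INF_cong)

lemma sub_exponential_withD:
  assumes sub: "sub_exponential_with P lam Z" and Z: "\<And>\<xi>. \<xi> \<in> space P \<Longrightarrow> Z \<xi> = ereal (Y \<xi>)"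
  shows "Y \<in> borel_measurable P" "integrable P Y" "expect P Z = ereal (\<integral>\<xi>. Y \<xi> \<partial>P)"
    "\<bar>\<tau>\<bar> * lam \<le> 1 \<Longrightarrow> (\<integral>\<^sup>+\<xi>. ennreal (exp (\<tau> * (Y \<xi> - (\<integral>\<xi>. Y \<xi> \<partial>P)))) \<partial>P) \<le> ennreal (exp (\<tau>\<^sup>2 * lam\<^sup>2 / 2))"
proof -
  have "(\<lambda>\<xi>. real_of_ereal (Z \<xi>)) \<in> borel_measurable P"
    using sub by (auto simp: sub_exponential_with_def)
  moreover have "(\<lambda>\<xi>. real_of_ereal (Z \<xi>)) \<in> borel_measurable P \<longleftrightarrow> Y \<in> borel_measurable P"
    by (rule measurable_cong) (simp add: Z)
  ultimately show Y: "Y \<in> borel_measurable P" by simp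
  have fin: "\<bar>expect P Z\<bar> \<noteq> \<infinity>" using sub by (simp add: sub_exponential_with_def)
  show "integrable P Y" by (rule expect_eq_integral(1)[OF Y Z fin])
  show ex: "expect P Z = ereal (\<integral>\<xi>. Y \<xi> \<partial>P)" by (rule expect_eq_integral(2)[OF Y Z fin])
  show "(\<integral>\<^sup>+\<xi>. ennreal (exp (\<tau> * (Y \<xi> - (\<integral>\<xi>. Y \<xi> \<partial>P)))) \<partial>P) \<le> ennreal (exp (\<tau>\<^sup>2 * lam\<^sup>2 / 2))"
    if "\<bar>\<tau>\<bar> * lam \<le> 1"
  proof -
    have "(\<integral>\<^sup>+\<xi>. ennreal (exp (\<tau> * (Y \<xi> - (\<integral>\<xi>. Y \<xi> \<partial>P)))) \<partial>P) =
      (\<integral>\<^sup>+\<xi>. ennreal (exp (\<tau> * (real_of_ereal (Z \<xi>) - real_of_ereal (expect P Z)))) \<partial>P)"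
      by (intro nn_integral_cong) (simp add: Z ex)
    then show ?thesis using sub that by (simp add: sub_exponential_with_def)
  qed
qed

lemma rate_asymptotics:
  assumes "0 < p" "1 \<le> n" "0 < b"
  obtains N where "3 \<le> N" "\<And>\<nu>. \<nu> \<ge> N \<Longrightarrow> rate n p \<nu> \<le> b" "\<And>\<nu>. \<nu> \<ge> N \<Longrightarrow> M \<le> real \<nu> * (rate n p \<nu>)\<^sup>2"
proof -
  have "\<forall>\<^sub>F \<nu> in sequentially. rate n p \<nu> < b"
    by (rule order_tendstoD(2)[OF rate_tendsto_0[OF assms(1)] assms(3)])
  moreover have "\<forall>\<^sub>F \<nu> in sequentially. M \<le> real \<nu> * (rate n p \<nu>)\<^sup>2"
    using rate_square_at_top[OF assms(1,2)] unfolding filterlim_at_top by blast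
  ultimately have "\<forall>\<^sub>F \<nu> in sequentially. rate n p \<nu> < b \<and> M \<le> real \<nu> * (rate n p \<nu>)\<^sup>2"
    by (rule eventually_conj)
  then obtain N where N: "\<forall>\<nu>\<ge>N. rate n p \<nu> < b \<and> M \<le> real \<nu> * (rate n p \<nu>)\<^sup>2"
    unfolding eventually_sequentially by blast
  show thesis by (rule that[of "max 3 N"]) (use N in \<open>auto intro: less_imp_le\<close>)
qed

text \<open>At radius \<open>rate powr (1 / p)\<close> the covering exponent is of the order of \<open>\<nu> * rate\<^sup>2\<close>, the
  exponent in the tail bound: this balance is what determines the rate.\<close>

lemma covering_exponent_le:
  assumes \<nu>: "3 \<le> \<nu>" and p: "0 < p" and C: "0 \<le> C" and r1: "rate n p \<nu> \<le> 1"
  defines "\<delta> \<equiv> rate n p \<nu> powr (1 / p)"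
  shows "C * ln (1 / \<delta>) ^ (n + 1) / \<delta> ^ n \<le> C / p ^ (n + 1) * (real \<nu> * (rate n p \<nu>)\<^sup>2)"
proof -
  define r where "r = rate n p \<nu>"
  have r: "0 < r" "r \<le> 1" using rate_pos[of \<nu> n p] \<nu> r1 by (auto simp: r_def)
  have "ln (1 / \<delta>) = ln (1 / r) / p"
    using r by (simp add: \<delta>_def r_def[symmetric] ln_div ln_powr)
  moreover have "ln (1 / r) / p \<le> ln (real \<nu>) / p"
    using ln_inverse_rate_le[OF \<nu> p, of n] p by (simp add: r_def divide_right_mono)
  moreover have "0 \<le> ln (1 / r) / p" using r p by simp
  ultimately have ln: "ln (1 / \<delta>) ^ (n + 1) \<le> (ln (real \<nu>) / p) ^ (n + 1)" by (intro power_mono) auto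
  have \<delta>n: "\<delta> ^ n = r powr (real n / p)"
    using r by (simp add: \<delta>_def r_def[symmetric] powr_realpow[symmetric] powr_powr)
  have "C * ln (1 / \<delta>) ^ (n + 1) / \<delta> ^ n \<le> C * (ln (real \<nu>) / p) ^ (n + 1) / \<delta> ^ n"
    unfolding \<delta>n by (intro divide_right_mono mult_left_mono ln C) simp
  also have "\<dots> = C / p ^ (n + 1) * (ln (real \<nu>) ^ (n + 1) / r powr (real n / p))"
    unfolding \<delta>n by (simp add: power_divide)
  also have "ln (real \<nu>) ^ (n + 1) / r powr (real n / p) = real \<nu> * r\<^sup>2"
    unfolding r_def using rate_square[of \<nu> p n] \<nu> p by simp
  finally show ?thesis by (simp add: r_def)
qed

theorem theorem5p4:
  fixes S :: "(real ^ 'n) set"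
    and P :: "'x measure"
    and F F0 :: "(real ^ 'n \<Rightarrow> ereal) set"
    and Fn :: "nat \<Rightarrow> (real ^ 'n \<Rightarrow> ereal) set"
    and \<psi> :: "'x \<Rightarrow> (real ^ 'n \<Rightarrow> ereal) \<Rightarrow> ereal"
    and \<kappa> :: "'x \<Rightarrow> real"
    and p \<alpha> :: real
  assumes S: "closed S" "0 \<in> S"
    and P: "prob_space P" "complete_measure P"
    and F: "closedin (Metric_space.mtopology (usc_fcns S) (aw_dist S)) F"
      "Metric_space.mbounded (usc_fcns S) (aw_dist S) F"
    and F0: "F0 \<subseteq> F" "closedin (Metric_space.mtopology (usc_fcns S) (aw_dist S)) F0"
    and Fn: "\<And>\<nu>. \<nu> \<ge> 1 \<Longrightarrow> Fn \<nu> \<subseteq> F"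
      "\<And>\<nu>. \<nu> \<ge> 1 \<Longrightarrow> closedin (Metric_space.mtopology (usc_fcns S) (aw_dist S)) (Fn \<nu>)"
    and psi_range: "\<And>\<xi> f. \<xi> \<in> space P \<Longrightarrow> f \<in> F \<Longrightarrow> - \<infinity> < \<psi> \<xi> f"
    and psi_lsc: "random_lsc P F (aw_dist S) \<psi>"
    and p: "0 < p"
    and kappa: "integrable P \<kappa>" "\<And>\<xi>. \<xi> \<in> space P \<Longrightarrow> 0 \<le> \<kappa> \<xi>"
    and hoelder: "\<And>\<xi> f g. \<xi> \<in> space P \<Longrightarrow> f \<in> F \<Longrightarrow> g \<in> F \<Longrightarrow>
        \<bar>\<psi> \<xi> f - \<psi> \<xi> g\<bar> \<le> ereal (\<kappa> \<xi> * aw_dist S f g powr p)"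
    and subexp: "\<exists>lam\<ge>0. \<forall>f\<in>F. sub_exponential_with P lam (\<lambda>\<xi>. \<psi> \<xi> f)"
    and H: "little_o_seq (\<lambda>\<nu>. ph_dist (aw_dist S) (Fn \<nu>) F0)
        (\<lambda>\<nu>. min (rate CARD('n) p \<nu>) (rate CARD('n) p \<nu> powr (1 / p)))"
    and alpha: "0 < \<alpha>" "\<alpha> < 1"
  shows "\<exists>c\<ge>0. \<exists>N\<ge>1. \<forall>\<nu>\<ge>N. \<forall>\<epsilon>\<ge>0.
    measure (Pi\<^sub>M {1..\<nu>} (\<lambda>_. P))
      {x \<in> space (Pi\<^sub>M {1..\<nu>} (\<lambda>_. P)).
        exs (aw_dist S)
          (eps_argmin \<epsilon> (Fn \<nu>) (\<lambda>f. ereal (1 / real \<nu>) * (\<Sum>j=1..\<nu>. \<psi> (x j) f)))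
          (eps_argmin (\<epsilon> + c * rate CARD('n) p \<nu>) F0 (\<lambda>f. expect P (\<lambda>\<xi>. \<psi> \<xi> f)))
        \<le> ph_dist (aw_dist S) (Fn \<nu>) F0}
    \<ge> 1 - \<alpha>"
proof -
  interpret Metric_space "usc_fcns S" "aw_dist S" by (rule Metric_space_aw_dist[OF S(2)])
  interpret P: prob_space P by fact
  define d where "d = aw_dist S"
  define n where "n = CARD('n)"
  have n: "1 \<le> n" by (simp add: n_def Suc_leI)
  have d_nonneg: "0 \<le> d f g" for f g by (simp add: d_def)
  have F_sub: "F \<subseteq> usc_fcns S" using closedin_subset[OF F(1)] by simp
  obtain R where R: "0 \<le> R" "\<And>f. f \<in> F \<Longrightarrow> hdist S 0 f \<le> R"
    using mbounded_usc_fcns_imp_hdist_le[OF S(2) F_sub F(2)] by blast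
  obtain q C where q: "0 < q" and C: "0 \<le> C" and cover: "\<forall>\<delta>. 0 < \<delta> \<longrightarrow> \<delta> \<le> exp (- 1) \<longrightarrow>
      (\<exists>G. finite G \<and> G \<subseteq> F \<and> (\<forall>f\<in>F. \<exists>g\<in>G. aw_dist S f g \<le> q * \<delta>) \<and>
        real (card G) \<le> exp (C * ln (1 / \<delta>) ^ (n + 1) / \<delta> ^ n))"
    using usc_fcns_covering[OF S(2) F_sub R] unfolding n_def by blast
  have "mtotally_bounded F"
    by (rule covering_imp_mtotally_bounded[OF Metric_space_aw_dist[OF S(2)] F_sub q _ cover]) simp
  then have F_compact: "compactin mtopology F"
    by (rule compactin_of_mcomplete_mtotally_bounded[OF Metric_space_aw_dist[OF S(2)] mcomplete_usc_fcns[OF S] _ F(1)])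

  \<comment> \<open>Real-valued integrand and its expectation\<close>
  define Y where "Y \<xi> f = real_of_ereal (\<psi> \<xi> f)" for \<xi> f
  define m where "m f = (\<integral>\<xi>. Y \<xi> f \<partial>P)" for f
  have \<psi>Y: "\<psi> \<xi> f = ereal (Y \<xi> f)" if "\<xi> \<in> space P" "f \<in> F" for \<xi> f
    using hoelder[OF that that(2)] psi_range[OF that] by (cases "\<psi> \<xi> f") (auto simp: Y_def)
  have Y_hoelder: "\<bar>Y \<xi> f - Y \<xi> g\<bar> \<le> \<kappa> \<xi> * d f g powr p" if "\<xi> \<in> space P" "f \<in> F" "g \<in> F" for \<xi> f g
    using hoelder[OF that] by (simp add: \<psi>Y that d_def)
  obtain lam0 where lam0: "0 \<le> lam0" "\<And>f. f \<in> F \<Longrightarrow> sub_exponential_with P lam0 (\<lambda>\<xi>. \<psi> \<xi> f)"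
    using subexp by blast
  \<comment> \<open>\<open>lam0 = 0\<close> is allowed, whereas the tail bound divides by
    \<open>lam\<close>. A larger parameter restricts \<tau> further and weakens the bound.\<close>
  define lam where "lam = max lam0 1"
  have lam: "0 < lam" "lam0 \<le> lam" by (auto simp: lam_def)
  have Y_facts: "(\<lambda>\<xi>. Y \<xi> f) \<in> borel_measurable P" "integrable P (\<lambda>\<xi>. Y \<xi> f)"
      "expect P (\<lambda>\<xi>. \<psi> \<xi> f) = ereal (m f)" if "f \<in> F" for f
    using sub_exponential_withD(1-3)[OF lam0(2)[OF that] \<psi>Y[OF _ that]] by (auto simp: m_def)
  have mgf: "(\<integral>\<^sup>+\<xi>. ennreal (exp (\<tau> * (Y \<xi> f - m f))) \<partial>P) \<le> ennreal (exp (\<tau>\<^sup>2 * lam\<^sup>2 / 2))"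
    if "f \<in> F" "\<bar>\<tau>\<bar> * lam \<le> 1" for f \<tau>
  proof -
    have "\<bar>\<tau>\<bar> * lam0 \<le> \<bar>\<tau>\<bar> * lam" by (intro mult_left_mono lam) simp
    then have "(\<integral>\<^sup>+\<xi>. ennreal (exp (\<tau> * (Y \<xi> f - m f))) \<partial>P) \<le> ennreal (exp (\<tau>\<^sup>2 * lam0\<^sup>2 / 2))"
      unfolding m_def using that(2) by (intro sub_exponential_withD(4)[OF lam0(2)[OF that(1)] \<psi>Y[OF _ that(1)]]) auto
    also have "\<dots> \<le> ennreal (exp (\<tau>\<^sup>2 * lam\<^sup>2 / 2))"
      using lam lam0(1) by (intro ennreal_leI) (auto intro!: divide_right_mono mult_left_mono power_mono)
    finally show ?thesis .
  qed
  define k where "k = (\<integral>\<xi>. \<kappa> \<xi> \<partial>P)"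
  have k: "0 \<le> k" unfolding k_def by (intro integral_nonneg_AE AE_I2 kappa(2))
  have m_hoelder: "\<bar>m f - m g\<bar> \<le> k * d f g powr p" if f: "f \<in> F" and g: "g \<in> F" for f g
  proof -
    have "\<bar>m f - m g\<bar> = \<bar>\<integral>\<xi>. Y \<xi> f - Y \<xi> g \<partial>P\<bar>"
      using Y_facts(2)[OF f] Y_facts(2)[OF g] by (simp add: m_def)
    also have "\<dots> \<le> (\<integral>\<xi>. \<bar>Y \<xi> f - Y \<xi> g\<bar> \<partial>P)" by (rule integral_abs_bound)
    also have "\<dots> \<le> (\<integral>\<xi>. \<kappa> \<xi> * d f g powr p \<partial>P)"
    proof (rule integral_mono)
      show "integrable P (\<lambda>\<xi>. \<bar>Y \<xi> f - Y \<xi> g\<bar>)"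
        by (intro integrable_abs Bochner_Integration.integrable_diff Y_facts(2) f g)
    qed (use kappa(1) Y_hoelder f g in auto)
    also have "\<dots> = k * d f g powr p" by (simp add: k_def)
    finally show ?thesis .
  qed

  \<comment> \<open>Choice of the constants\<close>
  define C2 where "C2 = C / p ^ (n + 1)"
  have C2: "0 \<le> C2" using C p by (simp add: C2_def)
  \<comment> \<open>At \<open>t = c1 * r\<close> the tail exponent is
    \<open>(C2 + 1) * \<nu> * r\<^sup>2\<close>: the part \<open>C2\<close> pays for the size of the
    net, and the remaining 1 leaves \<open>exp (- \<nu> * r\<^sup>2)\<close>.\<close>
  define c1 where "c1 = lam * sqrt (2 * (C2 + 1))"
  have c1: "0 < c1" "c1\<^sup>2 / (2 * lam\<^sup>2) = C2 + 1"
    using lam(1) C2 by (auto simp: c1_def power_mult_distrib)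
  \<comment> \<open>Markov's inequality gets one half of \<alpha>, the net the other half;
    \<open>k + 1\<close> keeps \<open>K\<close> positive when \<open>k = 0\<close>.\<close>
  define K where "K = 2 * (k + 1) / \<alpha>"
  have K: "0 < K" "k / K \<le> \<alpha> / 2" using k alpha by (auto simp: K_def field_simps)
  \<comment> \<open>\<open>a0 * r\<close> is the uniform deviation, because
    \<open>(q * \<delta>) powr p = q powr p * r\<close> for
    \<open>\<delta> = r powr (1 / p)\<close>.\<close>
  define a0 where "a0 = c1 + (K + k) * q powr p"
  define c where "c = 2 * a0 + 2 * k * 2 powr p"
  have c: "0 \<le> c" using c1 K k by (simp add: c_def a0_def)
  \<comment> \<open>The first bound gives \<open>\<delta> \<le> exp (- 1)\<close>, as the covering
    requires, the second gives \<open>c1 * r \<le> lam\<close>, as the tail bound requires.\<close>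
  define b where "b = min (exp (- p)) (lam / c1)"
  have b: "0 < b" using lam c1 by (simp add: b_def)
  obtain N1 where N1: "3 \<le> N1" "\<And>\<nu>. \<nu> \<ge> N1 \<Longrightarrow> rate n p \<nu> \<le> b"
      "\<And>\<nu>. \<nu> \<ge> N1 \<Longrightarrow> ln (4 / \<alpha>) \<le> real \<nu> * (rate n p \<nu>)\<^sup>2"
    using rate_asymptotics[OF p n b] by blast
  \<comment> \<open>The little-o condition with \<eta> = 1, so that moving between
    \<open>Fn \<nu>\<close> and \<open>F0\<close> costs at most the order of \<open>rate\<close> in
    the objective.\<close>
  obtain N2 where N2: "\<And>\<nu>. \<nu> \<ge> N2 \<Longrightarrow> ph_dist d (Fn \<nu>) F0 \<le> ereal (1 * min (rate n p \<nu>) (rate n p \<nu> powr (1 / p)))"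
    using H unfolding little_o_seq_def d_def n_def by (meson zero_less_one)

  \<comment> \<open>The estimate for a fixed sample size\<close>
  have main: "measure (sample P \<nu>)
      {x \<in> space (sample P \<nu>).
        exs d (eps_argmin \<epsilon> (Fn \<nu>) (\<lambda>f. ereal (1 / real \<nu>) * (\<Sum>j=1..\<nu>. \<psi> (x j) f)))
          (eps_argmin (\<epsilon> + c * rate n p \<nu>) F0 (\<lambda>f. expect P (\<lambda>\<xi>. \<psi> \<xi> f)))
        \<le> ph_dist d (Fn \<nu>) F0} \<ge> 1 - \<alpha>"
    if \<nu>: "\<nu> \<ge> max N1 N2" and \<epsilon>: "0 \<le> \<epsilon>" for \<nu> \<epsilon>
  proof -
    interpret Pi: prob_space "sample P \<nu>" by (intro prob_space_PiM P(1))
    have \<nu>': "3 \<le> \<nu>" "\<nu> \<ge> N1" "\<nu> \<ge> N2" "1 \<le> \<nu>" using \<nu> N1(1) by auto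
    define r where "r = rate n p \<nu>"
    have r: "0 < r" "r \<le> b" "ln (4 / \<alpha>) \<le> real \<nu> * r\<^sup>2"
      using rate_pos[of \<nu> n p] N1(2,3)[OF \<nu>'(2)] \<nu>'(1) by (auto simp: r_def)
    have ph: "ph_dist d (Fn \<nu>) F0 \<le> ereal (r powr (1 / p))"
      by (rule order_trans[OF N2[OF \<nu>'(3)]]) (simp add: r_def)
    have FnF: "Fn \<nu> \<subseteq> F" using Fn(1)[OF \<nu>'(4)] .
    define \<Phi> where "\<Phi> x f = (\<Sum>j=1..\<nu>. Y (x j) f) / real \<nu>" for x f
    define B where "B = eps_argmin (\<epsilon> + c * r) F0 (\<lambda>f. ereal (m f))"
    have B_eq: "eps_argmin (\<epsilon> + c * rate n p \<nu>) F0 (\<lambda>f. expect P (\<lambda>\<xi>. \<psi> \<xi> f)) = B"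
      unfolding B_def r_def by (rule eps_argmin_cong) (use Y_facts(3) F0 in auto)
    have A_eq: "eps_argmin \<epsilon> (Fn \<nu>) (\<lambda>f. ereal (1 / real \<nu>) * (\<Sum>j=1..\<nu>. \<psi> (x j) f))
        = eps_argmin \<epsilon> (Fn \<nu>) (\<lambda>f. ereal (\<Phi> x f))" if "x \<in> space (sample P \<nu>)" for x
    proof (rule eps_argmin_cong)
      fix f assume "f \<in> Fn \<nu>"
      then have "(\<Sum>j=1..\<nu>. \<psi> (x j) f) = (\<Sum>j=1..\<nu>. ereal (Y (x j) f))"
        using that FnF by (intro sum.cong refl \<psi>Y) (auto simp: space_PiM)
      then show "ereal (1 / real \<nu>) * (\<Sum>j=1..\<nu>. \<psi> (x j) f) = ereal (\<Phi> x f)" by (simp add: \<Phi>_def)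
    qed
    define T where "T = {x \<in> space (sample P \<nu>).
        exs d (eps_argmin \<epsilon> (Fn \<nu>) (\<lambda>f. ereal (\<Phi> x f))) B \<le> ph_dist d (Fn \<nu>) F0}"
    have T_eq: "{x \<in> space (sample P \<nu>).
        exs d (eps_argmin \<epsilon> (Fn \<nu>) (\<lambda>f. ereal (1 / real \<nu>) * (\<Sum>j=1..\<nu>. \<psi> (x j) f)))
          (eps_argmin (\<epsilon> + c * rate n p \<nu>) F0 (\<lambda>f. expect P (\<lambda>\<xi>. \<psi> \<xi> f)))
        \<le> ph_dist d (Fn \<nu>) F0} = T"
      unfolding T_def B_eq using A_eq by (intro Collect_cong conj_cong refl) simp
    have "1 - \<alpha> \<le> measure (sample P \<nu>) T"
    \<comment> \<open>For empty \<open>Fn \<nu>\<close> the excess is 0 and the event is sure.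
      Otherwise finiteness of the Hausdorff distance forces \<open>F0\<close> to be
      nonempty.\<close>
    proof (cases "Fn \<nu> = {}")
      case True
      then have "T = space (sample P \<nu>)"
        using ph_dist_nonneg[of d "Fn \<nu>" F0] d_nonneg by (simp add: T_def eps_argmin_def exs_def)
      then have "measure (sample P \<nu>) T = 1" by (simp only: Pi.prob_space)
      then show ?thesis using alpha by linarith
    next
      case Fn_ne: False
      have F0_ne: "F0 \<noteq> {}"
      proof
        assume "F0 = {}"
        then have "exs d (Fn \<nu>) F0 = \<infinity>" using Fn_ne by (simp add: exs_def)
        then show False using ph by (simp add: ph_dist_def)
      qed
      obtain h where h: "ph_dist d (Fn \<nu>) F0 = ereal h" "0 \<le> h"
        using ph ph_dist_nonneg[of d "Fn \<nu>" F0] d_nonneg by (cases "ph_dist d (Fn \<nu>) F0") auto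
      have F0_compact: "compactin mtopology F0" by (rule closed_compactin[OF F_compact F0])
      have Fn_compact: "compactin mtopology (Fn \<nu>)" by (rule closed_compactin[OF F_compact FnF Fn(2)[OF \<nu>'(4)]])
      have "compact (m ` F0)"
        by (rule hoelder_compact_image[OF F0_compact p k]) (use m_hoelder F0 in \<open>auto simp: d_def\<close>)
      \<comment> \<open>An exact minimizer over \<open>F0\<close> keeps \<open>B\<close> nonempty
        even when the tolerance is 0.\<close>
      then obtain g where g: "g \<in> F0" "\<And>f. f \<in> F0 \<Longrightarrow> m g \<le> m f"
        using compact_attains_inf[of "m ` F0"] F0_ne by auto
      have "ereal (m g) \<le> (INF f\<in>F0. ereal (m f))" by (rule INF_greatest) (use g in auto)
      also have "\<dots> \<le> (INF f\<in>F0. ereal (m f)) + ereal (\<epsilon> + c * r)"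
        using add_left_mono[of 0 "ereal (\<epsilon> + c * r)" "INF f\<in>F0. ereal (m f)"] \<epsilon> c r by simp
      finally have B_ne: "B \<noteq> {}" using g(1) by (auto simp: B_def eps_argmin_def)
      have B_sub: "B \<subseteq> usc_fcns S" using F0(1) F_sub by (auto simp: B_def eps_argmin_def)
      have \<Phi>_hoelder: "\<bar>\<Phi> x f - \<Phi> x g\<bar> \<le> (\<Sum>j=1..\<nu>. \<kappa> (x j)) / real \<nu> * d f g powr p"
        if x: "x \<in> space (sample P \<nu>)" and f: "f \<in> Fn \<nu>" and g: "g \<in> Fn \<nu>" for x f g
      proof -
        have "\<bar>\<Phi> x f - \<Phi> x g\<bar> = \<bar>\<Sum>j=1..\<nu>. Y (x j) f - Y (x j) g\<bar> / real \<nu>"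
          by (simp add: \<Phi>_def sum_subtractf diff_divide_distrib[symmetric] abs_divide)
        also have "\<dots> \<le> (\<Sum>j=1..\<nu>. \<kappa> (x j) * d f g powr p) / real \<nu>"
          using x f g FnF
          by (intro divide_right_mono order_trans[OF sum_abs sum_mono] Y_hoelder) (auto simp: space_PiM)
        finally show ?thesis by (simp add: sum_distrib_right)
      qed
      have T_sets: "T \<in> sets (sample P \<nu>)"
        unfolding T_def h(1) unfolding d_def
      proof (rule measurable_exs_eps_argmin[OF Fn_compact Fn_ne B_ne B_sub h(2) _ p _ \<Phi>_hoelder[unfolded d_def]])
        fix f assume "f \<in> Fn \<nu>"
        then have [measurable]: "(\<lambda>\<xi>. Y \<xi> f) \<in> borel_measurable P" using Y_facts(1) FnF by blast
        show "(\<lambda>x. \<Phi> x f) \<in> borel_measurable (sample P \<nu>)" unfolding \<Phi>_def by measurable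
      next
        fix x assume "x \<in> space (sample P \<nu>)"
        then show "0 \<le> (\<Sum>j=1..\<nu>. \<kappa> (x j)) / real \<nu>"
          by (intro divide_nonneg_nonneg sum_nonneg kappa(2)) (auto simp: space_PiM)
      qed
      define \<delta> where "\<delta> = r powr (1 / p)"
      have r_small: "r \<le> exp (- p)" "r \<le> lam / c1" using r(2) by (auto simp: b_def)
      have \<delta>: "0 < \<delta>" using r by (simp add: \<delta>_def)
      have "\<delta> \<le> exp (- p) powr (1 / p)" unfolding \<delta>_def using r r_small p by (intro powr_mono2) auto
      also have "\<dots> = exp (- 1)" using p by (simp add: powr_def)
      finally have \<delta>1: "\<delta> \<le> exp (- 1)" .
      obtain G where G: "finite G" "G \<subseteq> F" "\<forall>f\<in>F. \<exists>g\<in>G. aw_dist S f g \<le> q * \<delta>"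
          "real (card G) \<le> exp (C * ln (1 / \<delta>) ^ (n + 1) / \<delta> ^ n)"
        using spec[OF cover, of \<delta>] \<delta> \<delta>1 by auto
      have "exp (- p) \<le> 1" using p by simp
      then have r1: "r \<le> 1" using r_small by linarith
      have card: "real (card G) \<le> exp (C2 * (real \<nu> * r\<^sup>2))"
        using G(4) covering_exponent_le[OF \<nu>'(1) p C, of n] r1
        unfolding \<delta>_def r_def C2_def by (meson exp_le_cancel_iff order_trans)
      define t where "t = c1 * r"
      have t: "0 < t" "t \<le> lam" using c1 r(1) r_small(2) by (auto simp: t_def field_simps)
      have "t\<^sup>2 / (2 * lam\<^sup>2) = (C2 + 1) * r\<^sup>2"
        unfolding c1(2)[symmetric] by (simp add: t_def power_mult_distrib)
      then have "real (card G) * (2 * exp (- (real \<nu> * (t\<^sup>2 / (2 * lam\<^sup>2)))))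
          \<le> exp (C2 * (real \<nu> * r\<^sup>2)) * (2 * exp (- (real \<nu> * ((C2 + 1) * r\<^sup>2))))"
        using card by (simp add: mult_right_mono)
      also have "\<dots> = 2 * exp (- (real \<nu> * r\<^sup>2))"
        by (simp add: exp_add[symmetric] algebra_simps)
      also have "\<dots> \<le> 2 * exp (- ln (4 / \<alpha>))" using r(3) by simp
      also have "\<dots> = \<alpha> / 2" using alpha by (simp add: exp_minus)
      finally have tail: "real (card G) * (2 * exp (- (real \<nu> * (t\<^sup>2 / (2 * lam\<^sup>2))))) \<le> \<alpha> / 2" .
      obtain E where E: "E \<in> sets (sample P \<nu>)"
        "measure (sample P \<nu>) E \<ge> 1 - (real (card G) * (2 * exp (- (real \<nu> * (t\<^sup>2 / (2 * lam\<^sup>2))))) + k / K)"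
        "\<forall>x\<in>E. \<forall>f\<in>F. \<bar>(\<Sum>j=1..\<nu>. Y (x j) f) / real \<nu> - m f\<bar> \<le> t + (K + k) * (q * \<delta>) powr p"
        by (rule uniform_deviation[OF P(1) G(1,2) bspec[OF G(3), folded d_def] d_nonneg less_imp_le[OF p]
              Y_facts(1) lam(1) mgf kappa Y_hoelder m_hoelder k_def t K(1) \<nu>'(4)]) (assumption | rule that)+
      have \<delta>p: "\<delta> powr p = r" using r p by (simp add: \<delta>_def powr_powr)
      have "E \<subseteq> T"
      proof
        \<comment> \<open>\<open>E\<close> does not involve \<epsilon>: uniform deviation alone puts
          a sample into the event.\<close>
        fix x assume x: "x \<in> E"
        have "exs d (eps_argmin \<epsilon> (Fn \<nu>) (\<lambda>f. ereal (\<Phi> x f))) (eps_argmin (\<epsilon> + c * r) F0 (\<lambda>f. ereal (m f)))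
            \<le> ph_dist d (Fn \<nu>) F0"
        proof (rule exs_eps_argmin_le[OF FnF F0(1) Fn_ne F0_ne d_nonneg \<delta> ph[folded \<delta>_def] _ p k m_hoelder])
          show "\<bar>\<Phi> x f - m f\<bar> \<le> t + (K + k) * (q * \<delta>) powr p" if "f \<in> F" for f
            unfolding \<Phi>_def using E(3) x that by blast
          show "2 * (t + (K + k) * (q * \<delta>) powr p) + 2 * k * (2 * \<delta>) powr p \<le> c * r"
            using \<delta> q by (simp add: powr_mult \<delta>p t_def c_def a0_def algebra_simps)
        qed
        then show "x \<in> T" using sets.sets_into_space[OF E(1)] x by (auto simp: T_def B_def)
      qed
      then have "measure (sample P \<nu>) E \<le> measure (sample P \<nu>) T"
        by (rule Pi.finite_measure_mono[OF _ T_sets])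
      then show ?thesis using E(2) tail K(2) by linarith
    qed
    then show ?thesis unfolding T_eq .
  qed
  show ?thesis
    by (intro exI[of _ c] exI[of _ "max N1 N2"] conjI allI impI)
      (use c N1(1) main in \<open>auto simp: d_def n_def\<close>)
qed

end
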